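(* Let $k\ge 3$ be an integer, $p=1-\frac1k$ and $\lambda=\frac{1}{10}-\frac{1}{2k}+\frac{1}{k^2}-\frac{1}{k^3}+\frac{2}{5k^4}$. For every real $\delta>0$ there is $\epsilon>0$ such that every graph $G$ with $n\ge 1/\epsilon$ vertices, at least $(p-\epsilon)\binom n2$ edges and at most $(\lambda+\epsilon)n^5$ copies of $C_5$ is within edit distance $\delta n^2$ from the Turán graph $T_k^n$.
   Context: A copy of $C_5$ in $G$ is a (not necessarily induced) subgraph of $G$ isomorphic to the $5$-cycle. The Turán graph $T_k^n$ is the complete $k$-partite graph on $n$ vertices with part sizes as equal as possible. The edit distance between two graphs on the same $n$-vertex set is the minimum number of adjacencies that must be changed (edges added or removed) in one to obtain a graph isomorphic to the other. *)

theory Defs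
  imports Complex_Main "HOL-Library.Disjoint_Sets"
begin

text \<open>A graph is a vertex set together with a set of edges, each edge being a two-element set
  of vertices.\<close>

definition simple_graph :: "'a set \<Rightarrow> 'a set set \<Rightarrow> bool" where
  "simple_graph V E \<longleftrightarrow> finite V \<and> E \<subseteq> {e. e \<subseteq> V \<and> card e = 2}"

definition graph_iso :: "'a set \<Rightarrow> 'a set set \<Rightarrow> 'b set \<Rightarrow> 'b set set \<Rightarrow> bool" where
  "graph_iso V E W F \<longleftrightarrow> (\<exists>f. bij_betw f V W \<and> (\<lambda>e. f ` e) ` E = F)"

definition cycle_edges :: "nat \<Rightarrow> nat set set" where
  "cycle_edges m = {{i, (i + 1) mod m} |i. i < m}"

text \<open>A copy is a subgraph \<open>(W, F)\<close>, so the labelings of one and the same 5-cycle are not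
  counted separately.\<close>

definition C5_copies :: "'a set \<Rightarrow> 'a set set \<Rightarrow> ('a set \<times> 'a set set) set" where
  "C5_copies V E =
     {(W, F). W \<subseteq> V \<and> F \<subseteq> E \<and> simple_graph W F \<and> graph_iso W F {..<5} (cycle_edges 5)}"

text \<open>A complete \<open>k\<close>-partite graph on \<open>V\<close> has part sizes as equal as possible iff any two of them
  differ by at most one. Parts may be empty, which happens exactly if \<open>V\<close> has fewer than \<open>k\<close>
  elements.\<close>

definition is_turan_graph :: "nat \<Rightarrow> 'a set \<Rightarrow> 'a set set \<Rightarrow> bool" where
  "is_turan_graph k V T \<longleftrightarrow> finite V \<and>
     (\<exists>P :: nat \<Rightarrow> 'a set.
        disjoint_family_on P {..<k} \<and> (\<Union>i<k. P i) = V \<and>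
        (\<forall>i<k. \<forall>j<k. card (P i) \<le> card (P j) + 1) \<and>
        T = {{u, v} |u v. \<exists>i<k. \<exists>j<k. i \<noteq> j \<and> u \<in> P i \<and> v \<in> P j})"

text \<open>For graphs on the same finite vertex set \<open>V\<close> the minimum ranges over a finite nonempty set,
  as \<open>F\<close> itself is one of the candidates \<open>F'\<close>.\<close>

definition edit_distance :: "'a set \<Rightarrow> 'a set set \<Rightarrow> 'a set set \<Rightarrow> nat" where
  "edit_distance V E F =
     Min ((\<lambda>F'. card ((E - F') \<union> (F' - E))) ` {F'. simple_graph V F' \<and> graph_iso V F' V F})"

end

theory Submission
  imports Defs "HOL-Analysis.Convex"
begin

text \<open>
  Let \<open>A\<close> be the adjacency matrix of the graph and \<open>B = J - A\<close> the non-adjacency matrix, with ones on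
  the diagonal. Expanding \<open>tr (J - B)^5\<close> expresses the number of closed 5-walks through the walk counts
  \<open>1\<^sup>T B^m 1\<close> for \<open>m \<le> 4\<close> and \<open>tr B^5\<close>. A closed walk is in particular a walk, so
  \<open>R = 1\<^sup>T B^4 1 - tr B^5\<close> is non-negative; and if \<open>u\<close> is the deviation of the \<open>B\<close>-degrees from their mean
  \<open>m\<close>, then what remains beyond the value of a regular graph is a positive definite quadratic form
  in \<open>u\<close> and \<open>B u\<close>. Hence a graph with nearly the minimum number of 5-cycles has nearly all
  \<open>B\<close>-degrees close to \<open>D = n/k\<close>, and \<open>R\<close> is small.

  Positivity of the Laplacian \<open>D - B\<close> together with
  \<open>D\<^sup>3 - B\<^sup>3 = (D - B) ((B + D/2)\<^sup>2 + 3/4 D\<^sup>2)\<close> then shows that almost all pairs of adjacent \<open>B\<close>-edges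
  span a \<open>B\<close>-triangle, that is, non-adjacency is almost transitive. So \<open>k\<close> vertices can be chosen
  greedily whose \<open>B\<close>-neighbourhoods are almost disjoint sets of size about \<open>n/k\<close>, and these are almost
  the parts of a Turan graph.
\<close>

section \<open>Closed 5-walks in terms of the non-adjacency matrix\<close>

text \<open>The laws for \<open>b\<close> are stated on the whole type, so rearranging sums over
  \<open>V\<close> needs no membership side conditions; \<open>nonadj\<close> satisfies them
  everywhere.\<close>

locale nonadjacency =
  fixes V :: "'a set" and b :: "'a \<Rightarrow> 'a \<Rightarrow> real"
  assumes finV: "finite V"
    and b01: "\<And>x y. b x y = 0 \<or> b x y = 1"
    and bsym: "\<And>x y. b x y = b y x"
begin

text \<open>Below, \<open>paths\<close>\<open>m\<close> is \<open>1\<^sup>T B^m 1\<close>, \<open>closed\<close>\<open>m\<close> is \<open>tr B^m\<close>, \<open>deg2\<close> is \<open>B\<^sup>2 1\<close>, and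
  \<open>adj_closed5\<close> is \<open>tr (J - B)^5\<close>.\<close>

definition n where "n = real (card V)"
definition deg where "deg x = (\<Sum>y\<in>V. b x y)"
definition codeg where "codeg x y = (\<Sum>z\<in>V. b x z * b z y)"
definition deg2 where "deg2 x = (\<Sum>y\<in>V. b x y * deg y)"
definition deg_sum where "deg_sum = (\<Sum>x\<in>V. deg x)"
definition paths2 where "paths2 = (\<Sum>x\<in>V. deg x ^ 2)"
definition paths3 where "paths3 = (\<Sum>x\<in>V. deg x * deg2 x)"
definition paths4 where "paths4 = (\<Sum>x\<in>V. deg2 x ^ 2)"
definition closed3 where "closed3 = (\<Sum>x\<in>V. \<Sum>y\<in>V. b x y * codeg x y)"
definition closed5 where "closed5 = (\<Sum>x\<in>V. \<Sum>y\<in>V. b x y * (\<Sum>z\<in>V. codeg x z * codeg z y))"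
definition adj_codeg where "adj_codeg x y = (\<Sum>z\<in>V. (1 - b x z) * (1 - b z y))"
definition adj_closed5 where "adj_closed5 = (\<Sum>x\<in>V. \<Sum>y\<in>V. (1 - b x y) * (\<Sum>z\<in>V. adj_codeg x z * adj_codeg z y))"

section \<open>Row sums and bilinear forms of the non-adjacency matrix\<close>

lemma codeg_sym: "codeg x y = codeg y x"
  unfolding codeg_def by (intro sum.cong refl) (simp add: bsym mult.commute)

lemma b_nonneg: "0 \<le> b x y" and b_le_1: "b x y \<le> 1"
  using b01[of x y] by auto

lemma sum_b_col: "(\<Sum>y\<in>V. b y x) = deg x"
  unfolding deg_def by (intro sum.cong refl bsym)

lemma sum_b_mult: "(\<Sum>x\<in>V. \<Sum>y\<in>V. f x * b x y) = (\<Sum>x\<in>V. f x * deg x)"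
  by (simp add: deg_def sum_distrib_left)

lemma sum_deg2: "(\<Sum>x\<in>V. deg2 x) = paths2"
proof -
  have "(\<Sum>x\<in>V. deg2 x) = (\<Sum>y\<in>V. \<Sum>x\<in>V. b x y * deg y)"
    unfolding deg2_def by (rule sum.swap)
  also have "\<dots> = paths2"
    by (simp add: sum_distrib_right[symmetric] sum_b_col paths2_def power2_eq_square)
  finally show ?thesis .
qed

lemma sum_codeg: "(\<Sum>y\<in>V. codeg x y) = deg2 x"
proof -
  have "(\<Sum>y\<in>V. codeg x y) = (\<Sum>z\<in>V. \<Sum>y\<in>V. b x z * b z y)"
    unfolding codeg_def by (rule sum.swap)
  also have "\<dots> = deg2 x"
    by (simp add: deg2_def deg_def sum_distrib_left)
  finally show ?thesis .
qed

text \<open>By symmetry of \<open>b\<close>, the form is the inner product of \<open>B f\<close>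
  with \<open>f'\<close>.\<close>

lemma sum_b_form: "(\<Sum>x\<in>V. \<Sum>y\<in>V. f x * b x y * f' y) = (\<Sum>y\<in>V. (\<Sum>x\<in>V. b y x * f x) * f' y)"
proof -
  have "(\<Sum>x\<in>V. \<Sum>y\<in>V. f x * b x y * f' y) = (\<Sum>y\<in>V. \<Sum>x\<in>V. f x * b x y * f' y)"
    by (rule sum.swap)
  also have "\<dots> = (\<Sum>y\<in>V. (\<Sum>x\<in>V. b y x * f x) * f' y)"
    by (intro sum.cong refl) (simp add: sum_distrib_left sum_distrib_right bsym mult_ac)
  finally show ?thesis .
qed

text \<open>\<open>B\<^sup>2\<close> is the Gram matrix of the rows of \<open>B\<close>, so the form
  is the inner product of \<open>B f\<close> and \<open>B f'\<close>.\<close>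

lemma sum_codeg_form: "(\<Sum>x\<in>V. \<Sum>y\<in>V. f x * codeg x y * f' y)
    = (\<Sum>z\<in>V. (\<Sum>x\<in>V. b z x * f x) * (\<Sum>y\<in>V. b z y * f' y))"
proof -
  have "(\<Sum>x\<in>V. \<Sum>y\<in>V. f x * codeg x y * f' y)
      = (\<Sum>x\<in>V. \<Sum>y\<in>V. \<Sum>z\<in>V. (b z x * f x) * (b z y * f' y))"
    unfolding codeg_def
    by (intro sum.cong refl) (simp add: sum_distrib_left sum_distrib_right bsym mult_ac)
  also have "\<dots> = (\<Sum>x\<in>V. \<Sum>z\<in>V. \<Sum>y\<in>V. (b z x * f x) * (b z y * f' y))"
    by (intro sum.cong refl sum.swap)
  also have "\<dots> = (\<Sum>z\<in>V. \<Sum>x\<in>V. \<Sum>y\<in>V. (b z x * f x) * (b z y * f' y))"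
    by (rule sum.swap)
  also have "\<dots> = (\<Sum>z\<in>V. (\<Sum>x\<in>V. b z x * f x) * (\<Sum>y\<in>V. b z y * f' y))"
    by (simp add: sum_product)
  finally show ?thesis .
qed

lemma sum_codeg_sq: "(\<Sum>x\<in>V. \<Sum>y\<in>V. \<Sum>z\<in>V. codeg x z * codeg z y) = paths4"
proof -
  have "(\<Sum>x\<in>V. \<Sum>y\<in>V. \<Sum>z\<in>V. codeg x z * codeg z y) = (\<Sum>x\<in>V. \<Sum>z\<in>V. \<Sum>y\<in>V. codeg x z * codeg z y)"
    by (intro sum.cong refl sum.swap)
  also have "\<dots> = (\<Sum>x\<in>V. \<Sum>z\<in>V. codeg x z * deg2 z)"
    by (simp add: sum_distrib_left[symmetric] sum_codeg)
  also have "\<dots> = (\<Sum>z\<in>V. \<Sum>x\<in>V. codeg z x * deg2 z)"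
    by (subst sum.swap) (simp add: codeg_sym)
  also have "\<dots> = paths4"
    by (simp add: sum_distrib_right[symmetric] sum_codeg paths4_def power2_eq_square)
  finally show ?thesis .
qed

lemma adj_codeg_eq: "adj_codeg x y = n - deg x - deg y + codeg x y"
proof -
  have "adj_codeg x y = (\<Sum>z\<in>V. 1 - b x z - b z y + b x z * b z y)"
    unfolding adj_codeg_def by (intro sum.cong refl) (simp add: algebra_simps)
  also have "\<dots> = n - deg x - deg y + codeg x y"
    by (simp add: sum.distrib sum_subtractf n_def codeg_def sum_b_col) (simp add: deg_def)
  finally show ?thesis .
qed

text \<open>\<open>adj_codeg\<close> is the square of \<open>A = J - B\<close>, so the trace of
  \<open>A\<^sup>5\<close> is the entry sum of \<open>A\<^sup>4\<close> minus the entry sum of its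
  entrywise product with \<open>B\<close>. As \<open>J\<close> has rank one, each factor
  \<open>J\<close> cuts a closed walk into open ones, and only \<open>B\<^sup>5\<close> keeps its
  trace.\<close>

lemma adj_closed5_expand:
  "adj_closed5 = n^5 - 5 * n^3 * deg_sum + 5 * n^2 * paths2 + 5 * n * deg_sum^2
      - 5 * n * paths3 - 5 * deg_sum * paths2 + 5 * paths4 - closed5"
proof -
  \<comment> \<open>\<open>r\<close> is the vector of row sums of \<open>A\<close>, \<open>q\<close>
    is \<open>B\<^sup>3 1\<close>, and \<open>h4\<close> is the matrix
    \<open>B\<^sup>4\<close>.\<close>
  define r where "r x = n - deg x" for x
  define q where "q x = (\<Sum>z\<in>V. codeg x z * deg z)" for x
  define h4 where "h4 x y = (\<Sum>z\<in>V. codeg x z * codeg z y)" for x y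
  have a4: "(\<Sum>z\<in>V. adj_codeg x z * adj_codeg z y) =
      n * r x * r y + r x * (deg2 y - deg_sum) + r y * (deg2 x - deg_sum) + paths2 - q x - q y + h4 x y" for x y
  proof -
    have "(\<Sum>z\<in>V. adj_codeg x z * adj_codeg z y) = (\<Sum>z\<in>V. r x * r y - r x * deg z + r x * codeg y z
        - r y * deg z + r y * codeg x z + deg z ^ 2 - codeg x z * deg z - codeg y z * deg z + codeg x z * codeg z y)"
      by (intro sum.cong refl)
        (simp add: adj_codeg_eq r_def codeg_sym[of y] algebra_simps power2_eq_square)
    also have "\<dots> = n * r x * r y + r x * (deg2 y - deg_sum) + r y * (deg2 x - deg_sum) + paths2 - q x - q y + h4 x y"
      unfolding sum.distrib sum_subtractf
      by (simp add: sum_distrib_left[symmetric] sum_codeg deg_sum_def[symmetric] paths2_def[symmetric]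
          q_def[symmetric] h4_def[symmetric] n_def[symmetric]) (simp add: algebra_simps)
    finally show ?thesis .
  qed
  have sr: "(\<Sum>x\<in>V. r x) = n^2 - deg_sum"
    by (simp add: r_def sum_subtractf deg_sum_def n_def power2_eq_square)
  have sq: "(\<Sum>x\<in>V. q x) = paths3"
    using sum_codeg_form[of "\<lambda>_. 1" deg]
    by (simp add: q_def paths3_def deg_def[symmetric] deg2_def[symmetric])
  have sqd: "(\<Sum>x\<in>V. q x * deg x) = paths4"
    using sum_codeg_form[of deg deg]
    by (simp add: q_def paths4_def deg2_def[symmetric] power2_eq_square sum_distrib_left sum_distrib_right mult_ac)
  have sh4: "(\<Sum>x\<in>V. \<Sum>y\<in>V. h4 x y) = paths4"
    unfolding h4_def by (rule sum_codeg_sq)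
  have br: "(\<Sum>x\<in>V. b y x * r x) = n * deg y - deg2 y" for y
    by (simp add: r_def algebra_simps sum_subtractf deg2_def) (simp add: deg_def sum_distrib_left)
  have "(\<Sum>x\<in>V. \<Sum>y\<in>V. \<Sum>z\<in>V. adj_codeg x z * adj_codeg z y) =
      n * (n^2 - deg_sum)^2 + 2 * (n^2 - deg_sum) * (paths2 - n * deg_sum) + n^2 * paths2 - 2 * n * paths3 + paths4"
    unfolding a4 sum.distrib sum_subtractf sh4
    by (simp add: sum_distrib_left[symmetric] sum_distrib_right[symmetric] sum_subtractf sr sq
        sum_deg2 sh4 n_def[symmetric] mult.assoc[symmetric] power2_eq_square)
  moreover have "(\<Sum>x\<in>V. \<Sum>y\<in>V. b x y * (\<Sum>z\<in>V. adj_codeg x z * adj_codeg z y)) =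
      n * (n^2 * deg_sum - 2 * n * paths2 + paths3) + 2 * (n * paths3 - paths4) - 2 * deg_sum * (n * deg_sum - paths2) + paths2 * deg_sum - 2 * paths4 + closed5"
  proof -
    have "(\<Sum>x\<in>V. \<Sum>y\<in>V. b x y * (\<Sum>z\<in>V. adj_codeg x z * adj_codeg z y)) =
      (\<Sum>x\<in>V. \<Sum>y\<in>V. n * (r x * b x y * r y) + r x * b x y * (deg2 y - deg_sum) + (deg2 x - deg_sum) * b x y * r y
         + paths2 * b x y - q x * b x y * 1 - 1 * b x y * q y + b x y * h4 x y)"
      unfolding a4 by (intro sum.cong refl) (simp add: algebra_simps)
    also have "\<dots> = n * (\<Sum>x\<in>V. \<Sum>y\<in>V. r x * b x y * r y)
        + (\<Sum>x\<in>V. \<Sum>y\<in>V. r x * b x y * (deg2 y - deg_sum))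
        + (\<Sum>x\<in>V. \<Sum>y\<in>V. (deg2 x - deg_sum) * b x y * r y) + paths2 * deg_sum
        - (\<Sum>x\<in>V. \<Sum>y\<in>V. q x * b x y * 1) - (\<Sum>x\<in>V. \<Sum>y\<in>V. 1 * b x y * q y) + closed5"
      unfolding sum.distrib sum_subtractf
      by (simp add: sum_distrib_left[symmetric] closed5_def h4_def deg_sum_def deg_def)
    also have "(\<Sum>x\<in>V. \<Sum>y\<in>V. r x * b x y * r y) = n^2 * deg_sum - 2 * n * paths2 + paths3"
    proof -
      have "(\<Sum>x\<in>V. \<Sum>y\<in>V. r x * b x y * r y) = (\<Sum>y\<in>V. n^2 * deg y - n * deg2 y - n * deg y ^ 2 + deg y * deg2 y)"
        unfolding sum_b_form br by (intro sum.cong refl) (simp add: r_def algebra_simps power2_eq_square)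
      then show ?thesis unfolding sum.distrib sum_subtractf
        by (simp add: sum_distrib_left[symmetric] deg_sum_def[symmetric] sum_deg2 paths2_def[symmetric] paths3_def[symmetric])
    qed
    also have e: "(\<Sum>x\<in>V. \<Sum>y\<in>V. r x * b x y * (deg2 y - deg_sum)) = n * paths3 - paths4 - deg_sum * (n * deg_sum - paths2)"
    proof -
      have "(\<Sum>x\<in>V. \<Sum>y\<in>V. r x * b x y * (deg2 y - deg_sum)) = (\<Sum>y\<in>V. n * (deg y * deg2 y) - deg2 y ^ 2 - deg_sum * n * deg y + deg_sum * deg2 y)"
        unfolding sum_b_form br by (intro sum.cong refl) (simp add: algebra_simps power2_eq_square)
      then show ?thesis unfolding sum.distrib sum_subtractf
        by (simp add: sum_distrib_left[symmetric] deg_sum_def[symmetric] sum_deg2 paths4_def[symmetric] paths3_def[symmetric] algebra_simps)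
    qed
    also have "(\<Sum>x\<in>V. \<Sum>y\<in>V. (deg2 x - deg_sum) * b x y * r y) = (\<Sum>x\<in>V. \<Sum>y\<in>V. r x * b x y * (deg2 y - deg_sum))"
      by (subst sum.swap) (simp add: bsym mult_ac)
    also note e
    also have "(\<Sum>x\<in>V. \<Sum>y\<in>V. q x * b x y * 1) = paths4"
      using sqd by (simp add: sum_b_mult)
    also have "(\<Sum>x\<in>V. \<Sum>y\<in>V. 1 * b x y * q y) = paths4"
      unfolding sum_b_form using sqd by (simp add: deg_def[symmetric] mult.commute)
    finally show ?thesis by (simp add: algebra_simps)
  qed
  moreover have "adj_closed5 = (\<Sum>x\<in>V. \<Sum>y\<in>V. \<Sum>z\<in>V. adj_codeg x z * adj_codeg z y) - (\<Sum>x\<in>V. \<Sum>y\<in>V. b x y * (\<Sum>z\<in>V. adj_codeg x z * adj_codeg z y))"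
    by (simp add: adj_closed5_def left_diff_distrib sum_subtractf)
  ultimately show ?thesis
    by (simp add: algebra_simps power2_eq_square power3_eq_cube power4_eq_xxxx numeral_eq_Suc)
qed

section \<open>Inequalities for closed walks\<close>

lemma n_nonneg: "0 \<le> n" by (simp add: n_def)

lemma deg_nonneg: "0 \<le> deg x" unfolding deg_def by (simp add: sum_nonneg b_nonneg)

lemma deg_le: "deg x \<le> n"
  unfolding deg_def n_def using sum_mono[of V "b x" "\<lambda>_. 1"] b_le_1 by simp

lemma codeg_nonneg: "0 \<le> codeg x y" unfolding codeg_def by (simp add: sum_nonneg b_nonneg)

lemma codeg_le: "codeg x y \<le> n"
proof -
  have "codeg x y \<le> (\<Sum>z\<in>V. 1)"
    unfolding codeg_def by (intro sum_mono mult_le_one b_nonneg b_le_1)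
  then show ?thesis by (simp add: n_def)
qed

lemma closed5_le_paths4: "closed5 \<le> paths4"
  unfolding closed5_def sum_codeg_sq[symmetric]
  by (intro sum_mono mult_left_le_one_le sum_nonneg mult_nonneg_nonneg codeg_nonneg b_nonneg b_le_1)

text \<open>With \<open>deg = m + u\<close> and \<open>u\<close> orthogonal to the constants, the
  walk counts are polynomials in \<open>m\<close> plus terms in \<open>U\<close>, \<open>X\<close>
  and \<open>Y\<close>. Four of the five copies of \<open>paths4\<close> are expanded this way; the
  fifth is kept paired with \<open>closed5\<close>.\<close>

lemma adj_closed5_lower_bound:
  assumes "n > 0" and m: "m = deg_sum / n"
  shows "adj_closed5 \<ge> n^5 - 5 * n^4 * m + 10 * n^3 * m^2 - 10 * n^2 * m^3 + 4 * n * m^4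
           + 5/16 * n^2 * (\<Sum>x\<in>V. (deg x - m)^2) + (paths4 - closed5)"
proof -
  define u where "u x = deg x - m" for x
  define v where "v x = (\<Sum>y\<in>V. b x y * u y)" for x
  define U where "U = (\<Sum>x\<in>V. u x ^ 2)"
  define X where "X = (\<Sum>x\<in>V. u x * v x)"
  define Y where "Y = (\<Sum>x\<in>V. v x ^ 2)"
  have deg_sum: "deg_sum = n * m" using assms by simp
  have deg: "deg x = m + u x" for x by (simp add: u_def)
  have su: "(\<Sum>x\<in>V. u x) = 0"
    using deg_sum by (simp add: u_def sum_subtractf deg_sum_def n_def)
  have deg2: "deg2 x = m^2 + m * u x + v x" for x
  proof -
    have "deg2 x = (\<Sum>y\<in>V. m * b x y + b x y * u y)"
      unfolding deg2_def by (intro sum.cong refl) (simp add: deg algebra_simps)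
    also have "\<dots> = m * deg x + v x"
      by (simp add: sum.distrib v_def deg_def sum_distrib_left)
    finally show ?thesis by (simp add: deg algebra_simps power2_eq_square)
  qed
  have paths2: "paths2 = n * m^2 + U"
  proof -
    have "paths2 = (\<Sum>x\<in>V. m^2 + 2 * m * u x + u x ^ 2)"
      unfolding paths2_def deg by (intro sum.cong refl) (simp add: power2_sum)
    then show ?thesis
      by (simp add: sum.distrib sum_distrib_left[symmetric] su U_def n_def)
  qed
  have sv: "(\<Sum>x\<in>V. v x) = U"
  proof -
    have "paths2 = n * m^2 + m * (\<Sum>x\<in>V. u x) + (\<Sum>x\<in>V. v x)"
      unfolding sum_deg2[symmetric] deg2 by (simp add: sum.distrib sum_distrib_left n_def)
    then show ?thesis using paths2 su by simp
  qed
  have paths3: "paths3 = n * m^3 + 2 * m * U + X"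
  proof -
    have "paths3 = (\<Sum>x\<in>V. m^3 + 2 * m^2 * u x + m * v x + m * u x ^ 2 + u x * v x)"
      unfolding paths3_def deg2 by (intro sum.cong refl)
        (simp add: deg algebra_simps power2_eq_square power3_eq_cube)
    then show ?thesis
      by (simp add: sum.distrib sum_distrib_left[symmetric] su sv U_def[symmetric] X_def[symmetric] n_def)
  qed
  have paths4: "paths4 = n * m^4 + 3 * m^2 * U + 2 * m * X + Y"
  proof -
    have "paths4 = (\<Sum>x\<in>V. m^4 + 2 * m^3 * u x + m^2 * u x ^ 2 + 2 * m^2 * v x + 2 * m * (u x * v x) + v x ^ 2)"
      unfolding paths4_def deg2 by (intro sum.cong refl)
        (simp add: algebra_simps power2_eq_square power3_eq_cube power4_eq_xxxx)
    then show ?thesis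
      by (simp add: sum.distrib sum_distrib_left[symmetric] su sv U_def[symmetric] X_def[symmetric]
          Y_def[symmetric] n_def)
  qed
  \<comment> \<open>This value completes the square: the form contains
    \<open>4 * Y - 4 * e * X\<close>, the start of the squared norm of
    \<open>2 v - e u\<close>.\<close>
  define e where "e = (5 * n - 8 * m) / 4"
  have sq: "0 \<le> 4 * Y - 4 * e * X + e^2 * U"
  proof -
    have "0 \<le> (\<Sum>x\<in>V. (2 * v x - e * u x)^2)" by (simp add: sum_nonneg)
    also have "\<dots> = (\<Sum>x\<in>V. 4 * v x ^ 2 - 4 * e * (u x * v x) + e^2 * u x ^ 2)"
      by (intro sum.cong refl) (simp add: algebra_simps power2_eq_square)
    also have "\<dots> = 4 * Y - 4 * e * X + e^2 * U"
      by (simp add: sum.distrib sum_subtractf sum_distrib_left[symmetric] U_def X_def Y_def)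
    finally show ?thesis .
  qed
  \<comment> \<open>What remains of the coefficient of \<open>U\<close> is \<open>5/16 * n^2\<close>
    plus a multiple of a square, hence the constant \<open>5/16\<close>.\<close>
  have "5 * n^2 - 15 * n * m + 12 * m^2 - e^2 - 5/16 * n^2 = 2/16 * (5 * n - 8 * m)^2"
    by (simp add: e_def field_simps power2_eq_square)
  then have "0 \<le> 5 * n^2 - 15 * n * m + 12 * m^2 - e^2 - 5/16 * n^2"
    by (metis zero_le_power2 mult_nonneg_nonneg zero_le_divide_iff zero_le_numeral)
  moreover have "0 \<le> U" by (simp add: U_def sum_nonneg)
  ultimately have "0 \<le> (5 * n^2 - 15 * n * m + 12 * m^2 - e^2 - 5/16 * n^2) * U" by simp
  then have *: "5/16 * n^2 * U \<le> (5 * n^2 - 15 * n * m + 12 * m^2) * U - 4 * e * X + 4 * Y"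
    using sq by (simp add: algebra_simps)
  have "adj_closed5 = n^5 - 5 * n^4 * m + 10 * n^3 * m^2 - 10 * n^2 * m^3 + 4 * n * m^4
      + ((5 * n^2 - 15 * n * m + 12 * m^2) * U - 4 * e * X + 4 * Y) + (paths4 - closed5)"
    unfolding adj_closed5_expand deg_sum paths2 paths3 paths4 e_def
    by (simp add: field_simps power2_eq_square power3_eq_cube power4_eq_xxxx numeral_eq_Suc)
  with * show ?thesis unfolding U_def u_def by linarith
qed

text \<open>If all degrees equal \<open>D\<close>, the right side minus the left is the trace of
  \<open>(D - B) M\<^sup>2\<close> with \<open>M = B\<^sup>2 + (D/2) B\<close>, which is
  non-negative. The last summand pays for replacing the degrees by \<open>D\<close>.\<close>

lemma cherry_bound:
  assumes D: "0 \<le> D" "D \<le> n"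
  shows "3/4 * D^2 * (paths2 - closed3) \<le> paths4 - closed5 + 4 * n^3 * (\<Sum>x\<in>V. \<bar>deg x - D\<bar>)"
proof -
  define \<tau> where "\<tau> = (\<Sum>x\<in>V. \<bar>deg x - D\<bar>)"
  \<comment> \<open>With \<open>c = D / 2\<close>, \<open>t4\<close> has the factor \<open>D\<close>
    both in \<open>Z\<close> and in the bound for \<open>W\<close>, so it cancels.\<close>
  define c where "c = D / 2"
  define M where "M x z = codeg x z + c * b x z" for x z
  define t4 where "t4 = (\<Sum>x\<in>V. \<Sum>z\<in>V. codeg x z ^ 2)"
  define Z where "Z = (\<Sum>x\<in>V. \<Sum>y\<in>V. \<Sum>z\<in>V. b x y * (M x z * M y z))"
  define W where "W = (\<Sum>x\<in>V. \<Sum>z\<in>V. deg x * M x z ^ 2)"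
  have \<tau>0: "0 \<le> \<tau>" by (simp add: \<tau>_def sum_nonneg)
  have W1: "(\<Sum>x\<in>V. \<Sum>y\<in>V. \<Sum>z\<in>V. b x y * M x z ^ 2) = W"
    unfolding W_def deg_def
    by (rule sum.cong[OF refl], subst sum.swap) (simp add: sum_distrib_right)
  have W2: "(\<Sum>x\<in>V. \<Sum>y\<in>V. \<Sum>z\<in>V. b x y * M y z ^ 2) = W"
    unfolding W1[symmetric] by (subst sum.swap) (simp add: bsym)
  \<comment> \<open>The Laplacian of \<open>B\<close> is positive semidefinite on the columns of \<open>M = B\<^sup>2 + (D/2) B\<close>.\<close>
  have "0 \<le> (\<Sum>x\<in>V. \<Sum>y\<in>V. \<Sum>z\<in>V. b x y * (M x z - M y z)^2)"
    by (intro sum_nonneg mult_nonneg_nonneg b_nonneg) simp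
  also have "\<dots> = (\<Sum>x\<in>V. \<Sum>y\<in>V. \<Sum>z\<in>V. b x y * M x z ^ 2 + b x y * M y z ^ 2 - 2 * (b x y * (M x z * M y z)))"
    by (intro sum.cong refl) (simp add: algebra_simps power2_eq_square)
  also have "\<dots> = 2 * W - 2 * Z"
    by (simp only: sum.distrib sum_subtractf W1 W2) (simp add: Z_def sum_distrib_left)
  finally have ZW: "Z \<le> W" by simp
  have bh: "(\<Sum>x\<in>V. \<Sum>y\<in>V. \<Sum>z\<in>V. b x y * (codeg x z * b y z)) = t4"
  proof -
    have "(\<Sum>x\<in>V. \<Sum>y\<in>V. \<Sum>z\<in>V. b x y * (codeg x z * b y z)) = (\<Sum>x\<in>V. \<Sum>z\<in>V. \<Sum>y\<in>V. codeg x z * (b x y * b y z))"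
      by (rule sum.cong[OF refl], subst sum.swap) (simp add: mult_ac)
    then show ?thesis
      by (simp add: sum_distrib_left[symmetric] codeg_def[symmetric] t4_def power2_eq_square)
  qed
  have hb: "(\<Sum>x\<in>V. \<Sum>y\<in>V. \<Sum>z\<in>V. b x y * (b x z * codeg y z)) = t4"
    unfolding bh[symmetric] by (subst sum.swap) (simp add: bsym mult_ac)
  have "Z = (\<Sum>x\<in>V. \<Sum>y\<in>V. \<Sum>z\<in>V. b x y * (codeg x z * codeg z y) + c * (b x y * (codeg x z * b y z))
      + c * (b x y * (b x z * codeg y z)) + c^2 * (b x y * (b x z * b z y)))"
    unfolding Z_def M_def
    by (intro sum.cong refl) (simp add: algebra_simps power2_eq_square bsym codeg_sym)
  also have "\<dots> = closed5 + 2 * c * t4 + c^2 * closed3"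
    using bh hb unfolding sum.distrib sum_distrib_left[symmetric] closed5_def[symmetric]
      codeg_def[symmetric] closed3_def[symmetric] by simp
  finally have Z: "Z = closed5 + 2 * c * t4 + c^2 * closed3" .
  \<comment> \<open>The price of replacing degrees by \<open>D\<close>: each \<open>x\<close> loses
    at most \<open>\<bar>deg x - D\<bar> * K\<close> for each of the \<open>n\<close> values of
    \<open>z\<close>.\<close>
  have dD: "(\<Sum>x\<in>V. \<Sum>z\<in>V. deg x * f x z) \<le> D * (\<Sum>x\<in>V. \<Sum>z\<in>V. f x z) + K * n * \<tau>"
    if f: "\<And>x z. 0 \<le> f x z" "\<And>x z. f x z \<le> K" for f :: "'a \<Rightarrow> 'a \<Rightarrow> real" and K
  proof -
    have "(\<Sum>x\<in>V. \<Sum>z\<in>V. deg x * f x z) \<le> (\<Sum>x\<in>V. \<Sum>z\<in>V. D * f x z + \<bar>deg x - D\<bar> * K)"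
    proof (intro sum_mono)
      fix x z
      have "(deg x - D) * f x z \<le> \<bar>deg x - D\<bar> * K"
        using f[of x z] by (intro mult_mono) auto
      then show "deg x * f x z \<le> D * f x z + \<bar>deg x - D\<bar> * K" by (simp add: algebra_simps)
    qed
    also have "\<dots> = D * (\<Sum>x\<in>V. \<Sum>z\<in>V. f x z) + K * n * \<tau>"
      by (simp add: sum.distrib sum_distrib_left \<tau>_def n_def mult_ac)
    finally show ?thesis .
  qed
  have bb: "b x y ^ 2 = b x y" for x y using b01[of x y] by auto
  have "W = (\<Sum>x\<in>V. \<Sum>z\<in>V. deg x * codeg x z ^ 2 + 2 * c * (deg x * (b x z * codeg x z)) + c^2 * (deg x * b x z))"
    unfolding W_def M_def
    by (intro sum.cong refl) (simp add: algebra_simps power2_sum power_mult_distrib bb)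
  also have "\<dots> = (\<Sum>x\<in>V. \<Sum>z\<in>V. deg x * codeg x z ^ 2) + 2 * c * (\<Sum>x\<in>V. \<Sum>z\<in>V. deg x * (b x z * codeg x z)) + c^2 * paths2"
    by (simp add: sum.distrib sum_distrib_left[symmetric] paths2_def deg_def[symmetric] power2_eq_square)
  also have "\<dots> \<le> (D * t4 + n^2 * n * \<tau>) + 2 * c * (D * closed3 + n * n * \<tau>) + c^2 * paths2"
  proof -
    have 1: "(\<Sum>x\<in>V. \<Sum>z\<in>V. deg x * codeg x z ^ 2) \<le> D * t4 + n^2 * n * \<tau>"
      unfolding t4_def by (rule dD) (auto intro!: power_mono codeg_le codeg_nonneg)
    have 2: "(\<Sum>x\<in>V. \<Sum>z\<in>V. deg x * (b x z * codeg x z)) \<le> D * closed3 + n * n * \<tau>"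
      unfolding closed3_def
    proof (rule dD)
      fix x z
      show "0 \<le> b x z * codeg x z" by (simp add: b_nonneg codeg_nonneg)
      show "b x z * codeg x z \<le> n" using b01[of x z] codeg_le[of x z] n_nonneg by auto
    qed
    have "0 \<le> 2 * c" using D by (simp add: c_def)
    from 1 mult_left_mono[OF 2 this] show ?thesis by linarith
  qed
  finally have W: "W \<le> D * t4 + n^3 * \<tau> + D^2 * closed3 + D * n^2 * \<tau> + D^2 / 4 * paths2"
    by (simp add: c_def algebra_simps power2_eq_square power3_eq_cube)
  have "D * n^2 * \<tau> \<le> n * n^2 * \<tau>"
    using D \<tau>0 by (intro mult_right_mono) auto
  then have A: "closed5 \<le> 3/4 * D^2 * closed3 + D^2 / 4 * paths2 + 2 * n^3 * \<tau>"
    using ZW W unfolding Z c_def by (simp add: field_simps power2_eq_square power3_eq_cube)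
  \<comment> \<open>Both terms are sums of squares, of \<open>D * deg x\<close> and of
    \<open>deg2 x\<close>. The difference of these bases is a row of \<open>B\<close> applied to
    \<open>D - deg\<close>, hence at most \<open>\<tau>\<close>.\<close>
  have "D^2 * paths2 - paths4 \<le> 2 * n^3 * \<tau>"
  proof -
    have "D^2 * paths2 - paths4 = (\<Sum>x\<in>V. (D * deg x - deg2 x) * (D * deg x + deg2 x))"
      by (simp add: paths2_def paths4_def sum_distrib_left sum_subtractf[symmetric] algebra_simps power2_eq_square)
    also have "\<dots> \<le> (\<Sum>x\<in>V. \<tau> * (2 * n^2))"
    proof (rule sum_mono)
      fix x
      have "D * deg x - deg2 x = (\<Sum>y\<in>V. b x y * (D - deg y))"
        unfolding deg2_def deg_def[of x] by (simp add: sum_distrib_left sum_subtractf[symmetric] algebra_simps)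
      also have "\<dots> \<le> \<tau>" unfolding \<tau>_def
      proof (rule sum_mono)
        fix y show "b x y * (D - deg y) \<le> \<bar>deg y - D\<bar>" using b01[of x y] by auto
      qed
      finally have 1: "D * deg x - deg2 x \<le> \<tau>" .
      have "deg2 x \<le> (\<Sum>y\<in>V. n)" unfolding deg2_def
      proof (rule sum_mono)
        fix y show "b x y * deg y \<le> n" using b01[of x y] deg_le[of y] n_nonneg by auto
      qed
      then have "deg2 x \<le> n^2" by (simp add: n_def power2_eq_square)
      moreover have "D * deg x \<le> n * n" using D deg_le[of x] deg_nonneg[of x] by (intro mult_mono) auto
      moreover have "0 \<le> deg2 x" unfolding deg2_def by (intro sum_nonneg mult_nonneg_nonneg b_nonneg deg_nonneg)
      moreover have "0 \<le> D * deg x" using D deg_nonneg[of x] by simp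
      ultimately have "0 \<le> D * deg x + deg2 x" "D * deg x + deg2 x \<le> 2 * n^2" by (auto simp: power2_eq_square)
      with 1 \<tau>0 show "(D * deg x - deg2 x) * (D * deg x + deg2 x) \<le> \<tau> * (2 * n^2)"
        by (intro mult_mono) auto
    qed
    also have "\<dots> = 2 * n^3 * \<tau>" by (simp add: n_def power2_eq_square power3_eq_cube)
    finally show ?thesis .
  qed
  with A show ?thesis unfolding \<tau>_def[symmetric] by (simp add: field_simps)
qed

end

section \<open>Near-transitive non-adjacency gives a balanced partition\<close>

text \<open>Induction on \<open>k\<close>: the last part is filled up with vertices outside every
  \<open>Q i\<close>. Enough of them exist, because the other sets occupy at most the sum of their
  prescribed sizes.\<close>

lemma extend_disjoint_family:
  fixes k :: nat and s :: "nat \<Rightarrow> nat"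
  assumes "finite V" "disjoint_family_on Q {..<k}" "\<And>i. i < k \<Longrightarrow> Q i \<subseteq> V"
    "\<And>i. i < k \<Longrightarrow> card (Q i) \<le> s i" "(\<Sum>i<k. s i) = card V"
  shows "\<exists>P. disjoint_family_on P {..<k} \<and> (\<Union>i<k. P i) = V \<and> (\<forall>i<k. Q i \<subseteq> P i \<and> card (P i) = s i)"
  using assms
proof (induction k arbitrary: V)
  case 0
  then show ?case by (auto simp: disjoint_family_on_def)
next
  case (Suc k)
  have fin: "finite (Q i)" if "i < Suc k" for i
    using Suc.prems(1,3) that finite_subset by blast
  have disj: "Q i \<inter> Q j = {}" if "i < Suc k" "j < Suc k" "i \<noteq> j" for i j
    using Suc.prems(2) that unfolding disjoint_family_on_def by auto
  let ?X = "\<Union>i<Suc k. Q i"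
  have "card ?X = (\<Sum>i<Suc k. card (Q i))"
    by (rule card_UN_disjoint) (use fin disj in auto)
  also have "\<dots> = (\<Sum>i<k. card (Q i)) + card (Q k)" by simp
  also have "\<dots> \<le> (\<Sum>i<k. s i) + card (Q k)"
    using Suc.prems(4) by (intro add_right_mono sum_mono) auto
  finally have "card ?X \<le> (\<Sum>i<k. s i) + card (Q k)" .
  moreover have X: "?X \<subseteq> V" using Suc.prems(3) by auto
  moreover have "card (V - ?X) = card V - card ?X"
    using X Suc.prems(1) by (meson card_Diff_subset finite_subset)
  moreover have "card (Q k) \<le> s k" using Suc.prems(4) by simp
  ultimately have "s k - card (Q k) \<le> card (V - ?X)"
    using Suc.prems(5) by simp
  then obtain R where R: "R \<subseteq> V - ?X" "card R = s k - card (Q k)"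
    using obtain_subset_with_card_n by metis
  define Pk where "Pk = Q k \<union> R"
  have finR: "finite R" using R(1) Suc.prems(1) finite_subset by blast
  have "card Pk = card (Q k) + card R"
    unfolding Pk_def using R fin finR by (intro card_Un_disjoint) auto
  then have cPk: "card Pk = s k" using R(2) \<open>card (Q k) \<le> s k\<close> by simp
  have PkV: "Pk \<subseteq> V" using R(1) Suc.prems(3)[of k] by (auto simp: Pk_def)
  have QP: "Q i \<inter> Pk = {}" if "i < k" for i
    using R(1) disj[of i k] that by (auto simp: Pk_def)
  have "\<exists>P. disjoint_family_on P {..<k} \<and> (\<Union>i<k. P i) = V - Pk \<and> (\<forall>i<k. Q i \<subseteq> P i \<and> card (P i) = s i)"
  proof (rule Suc.IH)
    show "finite (V - Pk)" using Suc.prems(1) by simp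
    show "disjoint_family_on Q {..<k}" using Suc.prems(2) by (rule disjoint_family_on_mono[rotated]) auto
    show "Q i \<subseteq> V - Pk" if "i < k" for i using Suc.prems(3)[of i] QP[of i] that by auto
    show "card (Q i) \<le> s i" if "i < k" for i using Suc.prems(4) that by simp
    have "card (V - Pk) = card V - card Pk"
      using PkV Suc.prems(1) by (meson card_Diff_subset finite_subset)
    then show "(\<Sum>i<k. s i) = card (V - Pk)" using Suc.prems(5) cPk by simp
  qed
  then obtain P where P: "disjoint_family_on P {..<k}" "(\<Union>i<k. P i) = V - Pk"
    "\<And>i. i < k \<Longrightarrow> Q i \<subseteq> P i \<and> card (P i) = s i" by blast
  let ?P = "P(k := Pk)"
  have "disjoint_family_on ?P {..<Suc k}"
    using P(1,2) unfolding disjoint_family_on_def by (auto simp: less_Suc_eq) blast+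
  moreover have "(\<Union>i<Suc k. ?P i) = V"
  proof -
    have "(\<Union>i<Suc k. ?P i) = Pk \<union> (\<Union>i<k. P i)" by (auto simp: less_Suc_eq)
    then show ?thesis using P(2) PkV by auto
  qed
  moreover have "\<forall>i<Suc k. Q i \<subseteq> ?P i \<and> card (?P i) = s i"
    using P(3) cPk by (auto simp: less_Suc_eq Pk_def)
  ultimately show ?case by blast
qed

lemma sum_balanced_sizes:
  fixes m k :: nat
  assumes "k > 0"
  shows "(\<Sum>i<k. m div k + (if i < m mod k then 1 else 0)) = m"
proof -
  have "{..<k} \<inter> {i. i < m mod k} = {..<m mod k}" using assms by (auto intro: less_trans)
  then show ?thesis by (simp add: sum.distrib sum.If_cases)
qed

lemma markov_card:
  fixes f :: "'a \<Rightarrow> real"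
  assumes "finite A" "\<And>x. x \<in> A \<Longrightarrow> 0 \<le> f x"
  shows "c * card {x \<in> A. f x > c} \<le> sum f A"
proof -
  have "c * card {x \<in> A. f x > c} = (\<Sum>x\<in>{x \<in> A. f x > c}. c)" by simp
  also have "\<dots> \<le> (\<Sum>x\<in>{x \<in> A. f x > c}. f x)" by (rule sum_mono) auto
  also have "\<dots> \<le> sum f A" using assms by (intro sum_mono2) auto
  finally show ?thesis .
qed

lemma card_Un5_le: "card (A \<union> B \<union> C \<union> D \<union> E) \<le> card A + card B + card C + card D + card E"
  using card_Un_le[of A B] card_Un_le[of "A \<union> B" C] card_Un_le[of "A \<union> B \<union> C" D]
    card_Un_le[of "A \<union> B \<union> C \<union> D" E] by linarith

section \<open>Bad cherries, and a partition built from neighbourhoods\<close>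

context nonadjacency begin

text \<open>A cherry \<open>y - x - z\<close> of \<open>B\<close> is bad if its ends \<open>y, z\<close> are not \<open>B\<close>-adjacent. The next two count the
  bad cherries in which \<open>x\<close> is an end, and those in which \<open>x\<close> is the middle vertex.\<close>

definition end_cherries where "end_cherries x = (\<Sum>y\<in>V. \<Sum>z\<in>V. b x y * b y z * (1 - b x z))"
definition mid_cherries where "mid_cherries x = (\<Sum>y\<in>V. \<Sum>z\<in>V. b x y * b x z * (1 - b y z))"
definition nbhd where "nbhd x = {y \<in> V. b x y = 1}"

lemma end_cherries_nonneg: "0 \<le> end_cherries x"
  unfolding end_cherries_def by (intro sum_nonneg mult_nonneg_nonneg) (simp_all add: b_nonneg b_le_1)

lemma mid_cherries_nonneg: "0 \<le> mid_cherries x"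
  unfolding mid_cherries_def by (intro sum_nonneg mult_nonneg_nonneg) (simp_all add: b_nonneg b_le_1)

lemma end_cherries_eq: "end_cherries x = (\<Sum>z\<in>V. codeg x z * (1 - b x z))"
  unfolding end_cherries_def codeg_def by (subst sum.swap) (simp add: sum_distrib_right)

text \<open>Of the \<open>paths2\<close> walks of length two, those whose ends are joined are
  counted by \<open>closed3\<close>.\<close>

lemma sum_end_cherries: "(\<Sum>x\<in>V. end_cherries x) = paths2 - closed3"
proof -
  have "(\<Sum>x\<in>V. end_cherries x) = (\<Sum>x\<in>V. \<Sum>z\<in>V. codeg x z - b x z * codeg x z)"
    unfolding end_cherries_eq by (intro sum.cong refl) (simp add: algebra_simps)
  also have "\<dots> = paths2 - closed3" by (simp add: sum_subtractf sum_codeg sum_deg2 closed3_def)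
  finally show ?thesis .
qed

text \<open>Exchanging the first two vertices turns an end of a cherry into its middle, so both
  totals count the same triples.\<close>

lemma sum_mid_cherries: "(\<Sum>x\<in>V. mid_cherries x) = paths2 - closed3"
  unfolding sum_end_cherries[symmetric] end_cherries_def mid_cherries_def
  by (subst sum.swap) (simp add: bsym)

lemma finite_nbhd: "finite (nbhd x)" using finV by (simp add: nbhd_def)

lemma card_nbhd: "real (card (nbhd x)) = deg x"
proof -
  have "deg x = (\<Sum>y\<in>V. if b x y = 1 then 1 else 0)"
    unfolding deg_def by (intro sum.cong refl) (use b01 in auto)
  then show ?thesis by (simp add: nbhd_def sum.If_cases finV Int_def)
qed

lemma card_nbhd_Int: "real (card (nbhd x \<inter> nbhd y)) = codeg x y"
proof -
  have "codeg x y = (\<Sum>z\<in>V. if b x z = 1 \<and> b y z = 1 then 1 else 0)"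
    unfolding codeg_def
  proof (intro sum.cong refl)
    fix z show "b x z * b z y = (if b x z = 1 \<and> b y z = 1 then 1 else 0)"
      using b01[of x z] b01[of y z] bsym[of y z] by auto
  qed
  moreover have "nbhd x \<inter> nbhd y = {z \<in> V. b x z = 1 \<and> b y z = 1}" by (auto simp: nbhd_def)
  ultimately show ?thesis by (simp add: sum.If_cases finV Int_def)
qed

lemma card_pairs:
  "real (card {(y, z) \<in> V \<times> V. P y z}) = (\<Sum>y\<in>V. \<Sum>z\<in>V. if P y z then 1 else 0)"
proof -
  have "(\<Sum>y\<in>V. \<Sum>z\<in>V. if P y z then 1 else 0) = (\<Sum>p\<in>V \<times> V. if P (fst p) (snd p) then 1 else (0::real))"
    unfolding sum.cartesian_product by (intro sum.cong) auto
  also have "\<dots> = real (card ((V \<times> V) \<inter> {p. P (fst p) (snd p)}))"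
    using finV by (simp add: sum.If_cases)
  also have "(V \<times> V) \<inter> {p. P (fst p) (snd p)} = {(y, z) \<in> V \<times> V. P y z}" by auto
  finally show ?thesis by simp
qed

lemma card_end_cherries: "real (card {(y, z) \<in> V \<times> V. b x y = 1 \<and> b y z = 1 \<and> b x z = 0}) = end_cherries x"
  unfolding card_pairs end_cherries_def
proof (intro sum.cong refl)
  fix y z
  show "(if b x y = 1 \<and> b y z = 1 \<and> b x z = 0 then 1 else 0) = b x y * b y z * (1 - b x z)"
    using b01[of x y] b01[of x z] b01[of y z] by auto
qed

lemma card_mid_cherries: "real (card {(y, z) \<in> V \<times> V. b x y = 1 \<and> b x z = 1 \<and> b y z = 0}) = mid_cherries x"
  unfolding card_pairs mid_cherries_def
proof (intro sum.cong refl)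
  fix y z
  show "(if b x y = 1 \<and> b x z = 1 \<and> b y z = 0 then 1 else 0) = b x y * b x z * (1 - b y z)"
    using b01[of x y] b01[of x z] b01[of y z] by auto
qed

text \<open>The factor \<open>n\<close> brings the degree error to the scale \<open>n^2\<close> of
  the cherry counts, so that one averaging argument controls all three quantities.\<close>

definition defect where "defect D x = \<bar>deg x - D\<bar> * n + end_cherries x + mid_cherries x"

lemma defect_bounds:
  assumes "defect D x \<le> c * n^2" "n > 0"
  shows "\<bar>deg x - D\<bar> \<le> c * n" "end_cherries x \<le> c * n^2" "mid_cherries x \<le> c * n^2"
proof -
  have "\<bar>deg x - D\<bar> * n \<le> defect D x" "end_cherries x \<le> defect D x" "mid_cherries x \<le> defect D x"
    using end_cherries_nonneg[of x] mid_cherries_nonneg[of x] n_nonneg by (auto simp: defect_def)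
  then show "end_cherries x \<le> c * n^2" "mid_cherries x \<le> c * n^2" using assms by auto
  have "\<bar>deg x - D\<bar> * n \<le> (c * n) * n"
    using \<open>\<bar>deg x - D\<bar> * n \<le> defect D x\<close> assms(1) by (simp add: power2_eq_square mult.assoc)
  then show "\<bar>deg x - D\<bar> \<le> c * n" using assms(2) by simp
qed

text \<open>Few vertices have a large defect. For a vertex of small defect, the set
  \<open>Near\<close> of vertices sharing many neighbours with it has hardly more than
  \<open>n / k\<close> elements. Fewer than \<open>k\<close> such sets cannot cover
  \<open>V\<close>, so a further centre can always be chosen.\<close>

lemma greedy_centres:
  fixes k :: nat
  assumes k: "k > 0" and n: "n > 0" and \<sigma>: "0 < \<sigma>" "3 * real k ^ 2 * \<sigma> < 1"
    and tot: "(\<Sum>x\<in>V. defect (n / k) x) \<le> 3 * \<sigma>^4 * n^3"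
  shows "\<exists>f. \<forall>i<k. f i \<in> V \<and> defect (n / k) (f i) \<le> \<sigma>^2 * n^2 \<and> (\<forall>l<i. codeg (f l) (f i) \<le> \<sigma> * n)"
proof -
  let ?w = "defect (n / k)"
  have w0: "0 \<le> ?w x" for x
    using end_cherries_nonneg[of x] mid_cherries_nonneg[of x] n_nonneg by (simp add: defect_def)
  have "real k ^ 2 \<ge> 1" using k by simp
  then have "3 * \<sigma> \<le> 3 * real k ^ 2 * \<sigma>" using \<sigma> by simp
  then have \<sigma>1: "3 * \<sigma> < 1" using \<sigma> by linarith
  define Bad where "Bad = {x \<in> V. ?w x > \<sigma>^2 * n^2}"
  have "\<sigma>^2 * n^2 * real (card Bad) \<le> 3 * \<sigma>^4 * n^3"
    unfolding Bad_def using markov_card[of V ?w "\<sigma>^2 * n^2"] finV w0 tot by force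
  also have "\<dots> = \<sigma>^2 * n^2 * (3 * \<sigma>^2 * n)" by (simp add: power2_eq_square power3_eq_cube power4_eq_xxxx)
  finally have Bad: "real (card Bad) \<le> 3 * \<sigma>^2 * n"
    using n \<sigma> by (simp add: mult_le_cancel_left)
  define Near where "Near x = {z \<in> V. codeg x z > \<sigma> * n}" for x
  have Near: "real (card (Near x)) \<le> (1 / k + \<sigma>^2 + \<sigma>) * n" if "?w x \<le> \<sigma>^2 * n^2" for x
  proof -
    note db = defect_bounds[OF that n]
    \<comment> \<open>\<open>?F\<close> collects the non-neighbours of \<open>x\<close> reached by
      more than \<open>\<sigma> * n\<close> walks of length two; each such walk is a bad cherry with
      end \<open>x\<close>.\<close>
    let ?F = "{z \<in> V. codeg x z * (1 - b x z) > \<sigma> * n}"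
    have "\<sigma> * n * card ?F \<le> (\<Sum>z\<in>V. codeg x z * (1 - b x z))"
      by (rule markov_card) (simp_all add: finV codeg_nonneg b_le_1)
    also have "\<dots> \<le> \<sigma> * n * (\<sigma> * n)"
      using db(2) by (simp add: end_cherries_eq power2_eq_square mult_ac)
    finally have F: "card ?F \<le> \<sigma> * n"
      using n \<sigma> by (simp add: mult_le_cancel_left)
    have "Near x \<subseteq> nbhd x \<union> ?F"
    proof
      fix z assume "z \<in> Near x"
      then show "z \<in> nbhd x \<union> ?F" using b01[of x z] by (auto simp: Near_def nbhd_def)
    qed
    then have "card (Near x) \<le> card (nbhd x \<union> ?F)"
      using finV finite_nbhd by (intro card_mono) auto
    also have "\<dots> \<le> card (nbhd x) + card ?F" by (rule card_Un_le)
    finally have "real (card (Near x)) \<le> deg x + card ?F" using card_nbhd[of x] by linarith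
    also have "\<dots> \<le> n / k + \<sigma>^2 * n + \<sigma> * n" using db(1) F by linarith
    finally show ?thesis by (simp add: algebra_simps)
  qed
  have "\<exists>f. \<forall>i<j. f i \<in> V \<and> ?w (f i) \<le> \<sigma>^2 * n^2 \<and> (\<forall>l<i. codeg (f l) (f i) \<le> \<sigma> * n)" if "j \<le> k" for j
    using that
  proof (induction j)
    case 0
    then show ?case by simp
  next
    case (Suc j)
    then obtain f where f: "\<And>i. i < j \<Longrightarrow> f i \<in> V \<and> ?w (f i) \<le> \<sigma>^2 * n^2 \<and> (\<forall>l<i. codeg (f l) (f i) \<le> \<sigma> * n)"
      by (metis Suc_leD)
    let ?X = "Bad \<union> (\<Union>i<j. Near (f i))"
    have "card ?X \<le> card Bad + card (\<Union>i<j. Near (f i))" by (rule card_Un_le)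
    also have "\<dots> \<le> card Bad + (\<Sum>i<j. card (Near (f i)))"
      by (intro add_left_mono card_UN_le) simp
    finally have "real (card ?X) \<le> real (card Bad) + (\<Sum>i<j. real (card (Near (f i))))"
      by (metis of_nat_add of_nat_le_iff of_nat_sum)
    also have "\<dots> \<le> 3 * \<sigma>^2 * n + (\<Sum>i<j. (1 / k + \<sigma>^2 + \<sigma>) * n)"
      by (intro add_mono sum_mono Bad Near) (use f in auto)
    also have "\<dots> = (3 * \<sigma>^2 + j * (1 / k + \<sigma>^2 + \<sigma>)) * n" by (simp add: algebra_simps)
    \<comment> \<open>At most \<open>k - 1\<close> centres exist so far, so a fraction
      \<open>1 / k\<close> of the vertices is left up to error terms. These sum to at most
      \<open>(2 * k - 1) * \<sigma>\<close>, which is below \<open>1 / k\<close> by the bound on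
      \<open>\<sigma>\<close>.\<close>
    also have "\<dots> < 1 * n"
    proof (rule mult_strict_right_mono[OF _ n])
      have s2: "\<sigma>^2 \<le> \<sigma> * (1/3)" unfolding power2_eq_square using \<sigma> \<sigma>1 by (intro mult_left_mono) auto
      have "j * (1 / k + \<sigma>^2 + \<sigma>) \<le> (real k - 1) * (1 / k + \<sigma>^2 + \<sigma>)"
        using Suc.prems \<sigma> by (intro mult_right_mono) auto
      also have "\<dots> \<le> (real k - 1) * (1 / k + 2 * \<sigma>)"
        using s2 \<sigma> k by (intro mult_left_mono) auto
      finally have "3 * \<sigma>^2 + j * (1 / k + \<sigma>^2 + \<sigma>) \<le> \<sigma> + (real k - 1) * (1 / k + 2 * \<sigma>)"
        using s2 by linarith
      also have "\<dots> = 1 + (2 * real k - 1) * \<sigma> - 1 / k" using k by (simp add: field_simps)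
      also have "\<dots> < 1"
      proof -
        have "k * ((2 * real k - 1) * \<sigma>) \<le> 3 * real k ^ 2 * \<sigma>"
          using \<sigma> k by (simp add: power2_eq_square algebra_simps mult_right_mono)
        then have "k * ((2 * real k - 1) * \<sigma>) < 1" using \<sigma> by linarith
        then show ?thesis using k by (simp add: field_simps)
      qed
      finally show "3 * \<sigma>^2 + j * (1 / k + \<sigma>^2 + \<sigma>) < 1" .
    qed
    finally have "card ?X < card V" by (simp add: n_def)
    then have "?X \<noteq> V" by (metis less_irrefl)
    moreover have "?X \<subseteq> V" by (auto simp: Bad_def Near_def)
    ultimately obtain x where x: "x \<in> V" "x \<notin> ?X" by (metis psubsetI psubset_imp_ex_mem DiffD1 DiffD2)
    let ?f = "f(j := x)"
    have "\<forall>i<Suc j. ?f i \<in> V \<and> ?w (?f i) \<le> \<sigma>^2 * n^2 \<and> (\<forall>l<i. codeg (?f l) (?f i) \<le> \<sigma> * n)"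
      using f x by (auto simp: less_Suc_eq Bad_def Near_def not_less)
    then show ?case by blast
  qed
  then show ?thesis by blast
qed

text \<open>The neighbourhoods of the centres are made disjoint, trimmed and extended to a balanced
  partition. Apart from few exceptional vertices, each part lies in one neighbourhood, and there a
  pair on which \<open>b\<close> and the partition disagree produces a bad cherry or involves a
  common neighbour of two centres.\<close>

lemma near_balanced_partition:
  fixes k :: nat
  assumes k: "k \<ge> 3" and n: "n > 0" and \<sigma>: "0 < \<sigma>" "3 * real k ^ 2 * \<sigma> < 1" "1 \<le> \<sigma> * n"
    and tot: "(\<Sum>x\<in>V. defect (n / k) x) \<le> 3 * \<sigma>^4 * n^3"
  shows "\<exists>P. disjoint_family_on P {..<k} \<and> (\<Union>i<k. P i) = V \<and>
      (\<forall>i<k. \<forall>j<k. card (P i) \<le> card (P j) + 1) \<and>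
      card {(y, z) \<in> V \<times> V. (b y z = 1) \<noteq> (\<exists>i<k. y \<in> P i \<and> z \<in> P i)} \<le> 5 * real k ^ 2 * \<sigma> * n^2"
proof -
  have k0: "k > 0" using k by simp
  obtain f where f: "\<And>i. i < k \<Longrightarrow> f i \<in> V" "\<And>i. i < k \<Longrightarrow> defect (n / k) (f i) \<le> \<sigma>^2 * n^2"
    "\<And>i l. i < k \<Longrightarrow> l < i \<Longrightarrow> codeg (f l) (f i) \<le> \<sigma> * n"
    using greedy_centres[OF k0 n \<sigma>(1,2) tot] by blast
  have codeg: "codeg (f l) (f i) \<le> \<sigma> * n" if "i < k" "l < k" "i \<noteq> l" for i l
    using f(3)[of i l] f(3)[of l i] that codeg_sym[of "f l" "f i"] by (cases "l < i") auto
  note db = defect_bounds[OF f(2) n]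
  \<comment> \<open>Two centres have few common neighbours, so removing the earlier neighbourhoods
    costs at most \<open>k * (\<sigma> * n)\<close> vertices.\<close>
  define Q where "Q i = nbhd (f i) - (\<Union>l<i. nbhd (f l))" for i
  have cQ: "n / k - \<sigma>^2 * n - k * (\<sigma> * n) \<le> card (Q i)" if i: "i < k" for i
  proof -
    have "nbhd (f i) \<subseteq> Q i \<union> (\<Union>l<i. nbhd (f l) \<inter> nbhd (f i))" by (auto simp: Q_def)
    then have "card (nbhd (f i)) \<le> card (Q i \<union> (\<Union>l<i. nbhd (f l) \<inter> nbhd (f i)))"
      by (intro card_mono) (auto simp: Q_def finite_nbhd)
    also have "\<dots> \<le> card (Q i) + (\<Sum>l<i. card (nbhd (f l) \<inter> nbhd (f i)))"
      by (rule order_trans[OF card_Un_le]) (intro add_left_mono card_UN_le, simp)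
    finally have "deg (f i) \<le> card (Q i) + (\<Sum>l<i. codeg (f l) (f i))"
      unfolding card_nbhd[symmetric] card_nbhd_Int[symmetric]
      by (metis of_nat_add of_nat_le_iff of_nat_sum)
    also have "(\<Sum>l<i. codeg (f l) (f i)) \<le> (\<Sum>l<i. \<sigma> * n)"
      using f(3) i by (intro sum_mono) auto
    also have "\<dots> \<le> k * (\<sigma> * n)"
      using i \<sigma> n by (simp add: mult_right_mono)
    finally show ?thesis using db(1)[OF i] by linarith
  qed
  define c where "c = card V div k"
  \<comment> \<open>Trimming to at most \<open>c\<close> elements makes \<open>R i\<close> fit into
    a part of either size, \<open>c\<close> or \<open>c + 1\<close>.\<close>
  have "\<exists>R. R \<subseteq> Q i \<and> card R = min (card (Q i)) c" for i
    using obtain_subset_with_card_n[of "min (card (Q i)) c" "Q i"] by (metis min.cobounded1)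
  then obtain R where R: "\<And>i. R i \<subseteq> Q i" "\<And>i. card (R i) = min (card (Q i)) c" by metis
  define s where "s i = c + (if i < card V mod k then 1 else 0)" for i
  have "\<exists>P. disjoint_family_on P {..<k} \<and> (\<Union>i<k. P i) = V \<and> (\<forall>i<k. R i \<subseteq> P i \<and> card (P i) = s i)"
  proof (rule extend_disjoint_family[OF finV])
    have "disjoint_family_on Q {..<k}"
      unfolding disjoint_family_on_def
    proof (intro ballI impI)
      fix i j :: nat assume "i \<noteq> j"
      then consider "i < j" | "j < i" by linarith
      then show "Q i \<inter> Q j = {}" by cases (auto simp: Q_def)
    qed
    then show "disjoint_family_on R {..<k}"
      using R(1) unfolding disjoint_family_on_def by blast
    show "R i \<subseteq> V" for i using R(1)[of i] by (auto simp: Q_def nbhd_def)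
    show "card (R i) \<le> s i" for i using R(2)[of i] by (simp add: s_def)
    show "(\<Sum>i<k. s i) = card V" unfolding s_def c_def by (rule sum_balanced_sizes[OF k0])
  qed
  then obtain P where P: "disjoint_family_on P {..<k}" "(\<Union>i<k. P i) = V"
    "\<And>i. i < k \<Longrightarrow> R i \<subseteq> P i" "\<And>i. i < k \<Longrightarrow> card (P i) = s i" by blast
  have finP: "finite (P i)" if "i < k" for i
    using P(2) finV that by (metis UN_upper finite_subset lessThan_iff)
  have PN: "card (P i - nbhd (f i)) \<le> (2 + k) * \<sigma> * n" if i: "i < k" for i
  proof -
    have "P i - nbhd (f i) \<subseteq> P i - R i" using R(1)[of i] by (auto simp: Q_def)
    then have "card (P i - nbhd (f i)) \<le> card (P i - R i)"
      using finP[OF i] by (intro card_mono) auto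
    also have "\<dots> = s i - card (R i)"
      using P(3,4)[OF i] finP[OF i] by (metis card_Diff_subset finite_subset)
    finally have "real (card (P i - nbhd (f i))) \<le> real (s i - card (R i))" by simp
    also have "\<dots> = real (s i) - card (R i)"
      using R(2)[of i] by (simp add: s_def)
    also have "\<dots> \<le> 1 + \<sigma>^2 * n + k * (\<sigma> * n)"
    proof -
      have "real c \<le> n / k" unfolding c_def n_def by (rule of_nat_div_le_of_nat)
      moreover have "0 \<le> \<sigma>^2 * n" "0 \<le> k * (\<sigma> * n)" using n \<sigma> by auto
      ultimately show ?thesis
        using cQ[OF i] R(2)[of i] by (auto simp: s_def min_def split: if_splits)
    qed
    \<comment> \<open>The rounding error 1 of the part sizes is absorbed by
      \<open>1 \<le> \<sigma> * n\<close>.\<close>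
    also have "\<dots> \<le> \<sigma> * n + \<sigma> * n + k * (\<sigma> * n)"
    proof -
      have "real k ^ 2 \<ge> 1" using k0 by simp
      then have "\<sigma> \<le> 3 * real k ^ 2 * \<sigma>" using \<sigma> by simp
      then have "\<sigma> \<le> 1" using \<sigma> by linarith
      then have "\<sigma> * \<sigma> * n \<le> \<sigma> * 1 * n" using \<sigma> n by (intro mult_left_mono mult_right_mono) auto
      then show ?thesis using \<sigma>(3) unfolding power2_eq_square by simp
    qed
    finally show ?thesis by (simp add: algebra_simps)
  qed
  define Dis where "Dis = {(y, z) \<in> V \<times> V. (b y z = 1) \<noteq> (\<exists>i<k. y \<in> P i \<and> z \<in> P i)}"
  \<comment> \<open>The sources of disagreement: a vertex of a part outside the neighbourhood of its
    centre, a bad cherry with end or middle \<open>f i\<close>, or a common neighbour of two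
    centres.\<close>
  define C where "C i = (P i - nbhd (f i)) \<times> V \<union> V \<times> (P i - nbhd (f i))
      \<union> {(y, z) \<in> V \<times> V. b (f i) y = 1 \<and> b y z = 1 \<and> b (f i) z = 0}
      \<union> {(y, z) \<in> V \<times> V. b (f i) y = 1 \<and> b (f i) z = 1 \<and> b y z = 0}
      \<union> (\<Union>j\<in>{..<k} - {i}. V \<times> (nbhd (f j) \<inter> nbhd (f i)))" for i
  have sub: "Dis \<subseteq> (\<Union>i<k. C i)"
  proof (rule subrelI)
    fix y z assume yz: "(y, z) \<in> Dis"
    then have V: "y \<in> V" "z \<in> V" by (auto simp: Dis_def)
    then obtain i j where ij: "i < k" "j < k" "y \<in> P i" "z \<in> P j" using P(2) by blast
    show "(y, z) \<in> (\<Union>i<k. C i)"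
    proof (cases "y \<in> nbhd (f i) \<and> z \<in> nbhd (f j)")
      case False
      then have "(y, z) \<in> C i \<union> C j" using ij V by (auto simp: C_def)
      then show ?thesis using ij by auto
    next
      case True
      show ?thesis
      proof (cases "i = j")
        case eq: True
        then have "b y z = 0" using yz ij b01[of y z] by (auto simp: Dis_def)
        then have "(y, z) \<in> C i" using True eq V by (auto simp: C_def nbhd_def)
        then show ?thesis using ij by auto
      next
        case neq: False
        have disj: "l = l'" if "l < k" "l' < k" "t \<in> P l" "t \<in> P l'" for l l' t
          using P(1) that unfolding disjoint_family_on_def by blast
        have "\<not> (\<exists>l<k. y \<in> P l \<and> z \<in> P l)"
          using disj ij neq by metis
        then have "b y z = 1" using yz by (auto simp: Dis_def)
        \<comment> \<open>If \<open>z\<close> is not joined to \<open>f i\<close>, then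
          \<open>f i - y - z\<close> is a bad cherry; otherwise \<open>z\<close> is a common
          neighbour of \<open>f i\<close> and \<open>f j\<close>.\<close>
        then have "(y, z) \<in> C i"
          using True V ij neq b01[of "f i" z] by (auto simp: C_def nbhd_def)
        then show ?thesis using ij by auto
      qed
    qed
  qed
  have cC: "card (C i) \<le> ((5 + 3 * real k) * \<sigma> * n) * n" if i: "i < k" for i
  proof -
    let ?A = "P i - nbhd (f i)"
    have "card (C i) \<le> card (?A \<times> V) + card (V \<times> ?A)
        + card {(y, z) \<in> V \<times> V. b (f i) y = 1 \<and> b y z = 1 \<and> b (f i) z = 0}
        + card {(y, z) \<in> V \<times> V. b (f i) y = 1 \<and> b (f i) z = 1 \<and> b y z = 0}
        + (\<Sum>j\<in>{..<k} - {i}. card (V \<times> (nbhd (f j) \<inter> nbhd (f i))))"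
      unfolding C_def
      by (rule order_trans[OF card_Un5_le]) (intro add_left_mono card_UN_le, simp)
    then have "real (card (C i)) \<le> real (card (?A \<times> V)) + real (card (V \<times> ?A))
        + real (card {(y, z) \<in> V \<times> V. b (f i) y = 1 \<and> b y z = 1 \<and> b (f i) z = 0})
        + real (card {(y, z) \<in> V \<times> V. b (f i) y = 1 \<and> b (f i) z = 1 \<and> b y z = 0})
        + (\<Sum>j\<in>{..<k} - {i}. real (card (V \<times> (nbhd (f j) \<inter> nbhd (f i)))))"
      by (simp only: of_nat_add[symmetric] of_nat_sum[symmetric] of_nat_le_iff)
    also have "\<dots> = 2 * n * card ?A + end_cherries (f i) + mid_cherries (f i) + (\<Sum>j\<in>{..<k} - {i}. n * codeg (f j) (f i))"
      unfolding card_end_cherries card_mid_cherries card_cartesian_product of_nat_mult card_nbhd_Int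
      by (simp add: n_def)
    also have "\<dots> \<le> 2 * n * ((2 + k) * \<sigma> * n) + \<sigma>^2 * n^2 + \<sigma>^2 * n^2 + (\<Sum>j\<in>{..<k} - {i}. n * (\<sigma> * n))"
      by (intro add_mono sum_mono mult_left_mono PN codeg db i) (use n i in auto)
    finally have "card (C i) \<le> 2 * n * ((2 + k) * \<sigma> * n) + \<sigma>^2 * n^2 + \<sigma>^2 * n^2
        + (\<Sum>j\<in>{..<k} - {i}. n * (\<sigma> * n))" .
    moreover have "(\<Sum>j\<in>{..<k} - {i}. n * (\<sigma> * n)) \<le> k * (n * (\<sigma> * n))"
      using i \<sigma> n by (simp add: mult_right_mono)
    moreover have "\<sigma>^2 * n^2 \<le> \<sigma> / 2 * n^2"
    proof -
      have "real k ^ 2 \<ge> 1" using k0 by simp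
      then have "3 * \<sigma> \<le> 3 * real k ^ 2 * \<sigma>" using \<sigma> by simp
      then have "\<sigma> \<le> 1/2" using \<sigma> by linarith
      then have "\<sigma> * \<sigma> \<le> \<sigma> * (1/2)" using \<sigma> by (intro mult_left_mono) auto
      then have "\<sigma>^2 \<le> \<sigma> / 2" unfolding power2_eq_square by linarith
      then show ?thesis by (rule mult_right_mono) simp
    qed
    ultimately have "card (C i) \<le> 2 * n * ((2 + k) * \<sigma> * n) + \<sigma> / 2 * n^2 + \<sigma> / 2 * n^2
        + k * (n * (\<sigma> * n))" by linarith
    then show ?thesis by (simp add: algebra_simps power2_eq_square)
  qed
  have finC: "finite (C i)" if "i < k" for i
  proof (rule finite_subset)
    show "C i \<subseteq> V \<times> V" using P(2) that by (auto simp: C_def nbhd_def)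
  qed (use finV in simp)
  have "card Dis \<le> card (\<Union>i<k. C i)"
    using sub finC by (intro card_mono) auto
  also have "\<dots> \<le> (\<Sum>i<k. card (C i))" by (rule card_UN_le) simp
  finally have "real (card Dis) \<le> (\<Sum>i<k. real (card (C i)))"
    by (metis of_nat_le_iff of_nat_sum)
  also have "\<dots> \<le> (\<Sum>i<k. ((5 + 3 * real k) * \<sigma> * n) * n)"
    by (rule sum_mono) (use cC in auto)
  also have "\<dots> = (5 * real k + 3 * real k ^ 2) * (\<sigma> * n^2)"
    by (simp add: algebra_simps power2_eq_square)
  \<comment> \<open>The term linear in \<open>k\<close> is absorbed because
    \<open>k \<ge> 3\<close>.\<close>
  also have "\<dots> \<le> (5 * real k ^ 2) * (\<sigma> * n^2)"
  proof (rule mult_right_mono)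
    have "3 * real k \<le> real k * real k" using k by (intro mult_right_mono) auto
    then show "5 * real k + 3 * real k ^ 2 \<le> 5 * real k ^ 2" by (simp add: power2_eq_square)
  qed (use \<sigma> in auto)
  finally have "real (card Dis) \<le> 5 * real k ^ 2 * \<sigma> * n^2" by simp
  moreover have "\<forall>i<k. \<forall>j<k. card (P i) \<le> card (P j) + 1"
    using P(4) by (simp add: s_def)
  ultimately show ?thesis using P(1,2) unfolding Dis_def by blast
qed

end

section \<open>Near-extremal graphs have few bad cherries\<close>

text \<open>\<open>\<phi>\<close> is the main term of \<open>adj_closed5_lower_bound\<close> at
  \<open>m = s * n\<close>, divided by \<open>n^5\<close>. It is convex: after subtracting the
  tangent at \<open>a\<close>, the factor \<open>(s - a)^2\<close> splits off and leaves a positive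
  sum of squares and a constant.\<close>

lemma C5_polynomial_tangent:
  fixes a s :: real
  defines "\<phi> \<equiv> \<lambda>s::real. 1 - 5 * s + 10 * s^2 - 10 * s^3 + 4 * s^4"
  shows "\<phi> s \<ge> \<phi> a - (5 - 20 * a + 30 * a^2 - 16 * a^3) * (s - a)"
proof -
  have "\<phi> s - (\<phi> a - (5 - 20 * a + 30 * a^2 - 16 * a^3) * (s - a))
      = (s - a)^2 * ((2 * s + (4 * a - 5) / 2)^2 + ((8 * a - 5)^2 + 5) / 8)"
    unfolding \<phi>_def by (simp add: field_simps power2_eq_square power3_eq_cube power4_eq_xxxx)
  moreover have "\<dots> \<ge> 0" by (intro mult_nonneg_nonneg add_nonneg_nonneg) auto
  ultimately show ?thesis by linarith
qed

text \<open>This is the negative derivative of the quartic at \<open>a = 1/k\<close>. The lower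
  bound turns an excess of closed walks into a bound on \<open>a - s\<close>; the upper bound limits
  the loss when \<open>s\<close> exceeds \<open>a\<close>.\<close>

lemma C5_polynomial_slope:
  fixes a :: real
  assumes "0 \<le> a" "a \<le> 1/3"
  shows "5 - 20 * a + 30 * a^2 - 16 * a^3 \<ge> 1" "5 - 20 * a + 30 * a^2 - 16 * a^3 \<le> 5"
proof -
  have sq: "a^2 \<le> a / 3" using mult_left_mono[OF assms(2,1)] by (simp add: power2_eq_square)
  have cube: "a^3 \<le> a^2 / 3"
    using mult_left_mono[OF assms(2), of "a^2"] by (simp add: power3_eq_cube power2_eq_square)
  have "0 \<le> a^3" using assms by simp
  with sq assms show "5 - 20 * a + 30 * a^2 - 16 * a^3 \<le> 5" by linarith
  \<comment> \<open>The square is replaced by its tangent at \<open>1/3\<close>, the end of the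
    range where the expression is smallest.\<close>
  have "0 \<le> (a - 1/3)^2" by simp
  then have "a^2 \<ge> 2/3 * a - 1/9" by (simp add: power2_eq_square algebra_simps)
  with cube assms show "5 - 20 * a + 30 * a^2 - 16 * a^3 \<ge> 1" by linarith
qed

context nonadjacency begin

text \<open>The walk count exceeds the tangent bound by order \<open>\<epsilon>\<close> only, so the
  degree variance and \<open>paths4 - closed5\<close> are of that order. Passing from squared to
  absolute deviations by Cauchy-Schwarz costs the square root of \<open>\<epsilon>\<close>.\<close>

lemma defect_sum_bound:
  fixes k :: nat
  defines "a \<equiv> 1 / real k"
  assumes k: "k \<ge> 3" and n: "n > 0" and e: "0 < \<epsilon>" "\<epsilon> \<le> 1"
    and deg_sum: "deg_sum \<le> (a + 2 * \<epsilon>) * n^2"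
    and adj_closed5: "adj_closed5 \<le> (1 - 5 * a + 10 * a^2 - 10 * a^3 + 4 * a^4 + 20 * \<epsilon>) * n^5"
  shows "(\<Sum>x\<in>V. defect (n / k) x) \<le> 400 * real k ^ 2 * sqrt \<epsilon> * n^3"
proof -
  define s where "s = deg_sum / n^2"
  define m where "m = deg_sum / n"
  define c where "c = 5 - 20 * a + 30 * a^2 - 16 * a^3"
  define U where "U = (\<Sum>x\<in>V. (deg x - m)^2)"
  define D where "D = n / k"
  define \<tau> where "\<tau> = (\<Sum>x\<in>V. \<bar>deg x - D\<bar>)"
  define r where "r = sqrt \<epsilon>"
  have m: "m = s * n" using n by (simp add: m_def s_def power2_eq_square)
  have a: "0 \<le> a" "a \<le> 1/3" using k by (auto simp: a_def field_simps)
  have c: "1 \<le> c" "c \<le> 5" using C5_polynomial_slope[OF a] by (auto simp: c_def)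
  have sa: "s - a \<le> 2 * \<epsilon>" using deg_sum n by (simp add: s_def field_simps)
  have U0: "0 \<le> U" by (simp add: U_def sum_nonneg)
  have R0: "0 \<le> paths4 - closed5" using closed5_le_paths4 by simp
  have "adj_closed5 \<ge> n^5 * (1 - 5 * s + 10 * s^2 - 10 * s^3 + 4 * s^4) + 5/16 * n^2 * U + (paths4 - closed5)"
    using adj_closed5_lower_bound[OF n m_def] unfolding U_def m
    by (simp add: algebra_simps power_mult_distrib numeral_eq_Suc)
  moreover have "n^5 * (1 - 5 * s + 10 * s^2 - 10 * s^3 + 4 * s^4)
      \<ge> n^5 * (1 - 5 * a + 10 * a^2 - 10 * a^3 + 4 * a^4 - c * (s - a))"
    using C5_polynomial_tangent[of a s] n unfolding c_def by (intro mult_left_mono) auto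
  ultimately have main: "5/16 * n^2 * U + (paths4 - closed5) \<le> n^5 * (20 * \<epsilon> + c * (s - a))"
    using adj_closed5 by (simp add: algebra_simps)
  have "c * (s - a) \<le> c * (2 * \<epsilon>)" using sa c by (intro mult_left_mono) auto
  also have "\<dots> \<le> 10 * \<epsilon>" using c e by simp
  finally have "n^5 * (20 * \<epsilon> + c * (s - a)) \<le> n^5 * (30 * \<epsilon>)" using n by (intro mult_left_mono) auto
  with main have main': "5/16 * n^2 * U + (paths4 - closed5) \<le> 30 * \<epsilon> * n^5" by (simp add: mult_ac)
  then have R: "paths4 - closed5 \<le> 30 * \<epsilon> * n^5" using U0 by (smt (verit) mult_nonneg_nonneg zero_le_power2 divide_nonneg_nonneg)
  have "5/16 * n^2 * U \<le> 30 * \<epsilon> * n^5" using main' R0 by linarith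
  then have "n^2 * U \<le> n^2 * (96 * \<epsilon> * n^3)" by (simp add: numeral_eq_Suc mult_ac)
  then have U: "U \<le> 96 * \<epsilon> * n^3" using n by (simp add: mult_le_cancel_left)
  \<comment> \<open>The left side of \<open>main\<close> is non-negative, which bounds
    \<open>s\<close> from below: with far more edges there would be too many closed walks.\<close>
  have "0 \<le> n^5 * (20 * \<epsilon> + c * (s - a))" using main U0 R0 by (smt (verit) mult_nonneg_nonneg zero_le_power2 divide_nonneg_nonneg)
  then have "c * (a - s) \<le> 20 * \<epsilon>" using n by (simp only: zero_le_mult_iff) (auto simp: algebra_simps)
  moreover have "a - s \<le> c * (a - s)" if "a - s \<ge> 0" using mult_right_mono[OF c(1) that] by simp
  ultimately have as: "a - s \<le> 20 * \<epsilon>" using e by (cases "a - s \<ge> 0") auto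
  have sa2: "(s - a)^2 \<le> (20 * \<epsilon>)^2" using sa as e by (intro abs_le_square_iff[THEN iffD1]) auto
  have mD: "m - D = (s - a) * n" by (simp add: m D_def a_def algebra_simps)
  \<comment> \<open>Moving the reference point from the mean \<open>m\<close> to \<open>D\<close>
    adds only the square of the shift, since deviations from the mean sum to zero.\<close>
  have "(\<Sum>x\<in>V. (deg x - D)^2) = (\<Sum>x\<in>V. (deg x - m)^2 + 2 * (m - D) * (deg x - m) + (m - D)^2)"
    by (intro sum.cong refl) (simp add: power2_eq_square algebra_simps)
  also have "\<dots> = U + 2 * (m - D) * (\<Sum>x\<in>V. deg x - m) + n * (m - D)^2"
    by (simp add: sum.distrib sum_distrib_left U_def n_def)
  also have "(\<Sum>x\<in>V. deg x - m) = 0"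
    using n by (simp add: sum_subtractf deg_sum_def[symmetric] n_def[symmetric] m_def)
  finally have "(\<Sum>x\<in>V. (deg x - D)^2) = U + n^3 * (s - a)^2"
    by (simp add: mD power2_eq_square power3_eq_cube)
  also have "\<dots> \<le> 96 * \<epsilon> * n^3 + n^3 * (20 * \<epsilon>)^2"
    using n by (intro add_mono mult_left_mono U sa2) auto
  also have "\<dots> \<le> 96 * \<epsilon> * n^3 + n^3 * (400 * \<epsilon>)"
    using n e by (simp add: power2_eq_square)
  finally have sq: "(\<Sum>x\<in>V. (deg x - D)^2) \<le> 496 * \<epsilon> * n^3" by simp
  have \<tau>0: "0 \<le> \<tau>" by (simp add: \<tau>_def sum_nonneg)
  have r: "0 \<le> r" "r^2 = \<epsilon>" using e by (auto simp: r_def)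
  have r1: "r \<le> 1" using e by (simp add: r_def)
  have er: "\<epsilon> \<le> r" using r r1 by (metis mult_left_le power2_eq_square)
  have "\<tau>^2 \<le> n * (\<Sum>x\<in>V. (deg x - D)^2)"
    using Cauchy_Schwarz_ineq_sum[of "\<lambda>_. 1" "\<lambda>x. \<bar>deg x - D\<bar>" V] by (simp add: \<tau>_def n_def)
  also have "\<dots> \<le> n * (496 * \<epsilon> * n^3)" using sq n by (intro mult_left_mono) auto
  also have "\<dots> = 496 * (r * n^2)^2" by (simp add: r(2)[symmetric] power2_eq_square power3_eq_cube)
  \<comment> \<open>\<open>23^2 = 529\<close> exceeds 496.\<close>
  also have "\<dots> \<le> (23 * (r * n^2))^2" unfolding power_mult_distrib[of 23] by (intro mult_right_mono) auto
  finally have \<tau>: "\<tau> \<le> 23 * (r * n^2)" by (rule power2_le_imp_le) (use r in auto)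
  have "k \<ge> 1" using k by simp
  then have D: "0 \<le> D" "D \<le> n" using n by (auto simp: D_def field_simps)
  have "3/4 * D^2 * (paths2 - closed3) \<le> paths4 - closed5 + 4 * n^3 * \<tau>"
    using cherry_bound[OF D] by (simp add: \<tau>_def)
  also have "\<dots> \<le> 30 * \<epsilon> * n^5 + 4 * n^3 * (23 * (r * n^2))"
    using R \<tau> n by (intro add_mono mult_left_mono) auto
  also have "\<dots> \<le> 30 * r * n^5 + 4 * n^3 * (23 * (r * n^2))"
    using er n by (intro add_mono mult_right_mono mult_left_mono) auto
  also have "\<dots> = 122 * r * n^3 * n^2" by (simp add: numeral_eq_Suc)
  finally have "3/4 * (D^2 * (paths2 - closed3)) \<le> 122 * r * n^3 * n^2" by simp
  then have "(paths2 - closed3) * n^2 \<le> (122 * 4/3 * r * real k ^ 2 * n^3) * n^2"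
    using k by (simp add: D_def field_simps)
  then have Q: "paths2 - closed3 \<le> 122 * 4/3 * r * real k ^ 2 * n^3" using n by (simp add: mult_le_cancel_right)
  have "(\<Sum>x\<in>V. defect (n / k) x) = n * \<tau> + 2 * (paths2 - closed3)"
    by (simp add: defect_def sum.distrib sum_end_cherries sum_mid_cherries sum_distrib_right[symmetric] \<tau>_def D_def)
  also have "\<dots> \<le> n * (23 * (r * n^2)) + 2 * (122 * 4/3 * r * real k ^ 2 * n^3)"
    using \<tau> Q n by (intro add_mono mult_left_mono) auto
  \<comment> \<open>\<open>2 * 122 * 4/3\<close> is below 326, and \<open>23 + 326\<close> is below
    400.\<close>
  also have "\<dots> \<le> (23 * real k ^ 2) * (r * n^3) + 326 * real k ^ 2 * (r * n^3)"
  proof (rule add_mono)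
    have "n * (23 * (r * n^2)) = 23 * (r * n^3)" by (simp add: power2_eq_square power3_eq_cube)
    also have "\<dots> \<le> 23 * real k ^ 2 * (r * n^3)"
      using \<open>k \<ge> 1\<close> r n by (intro mult_right_mono) auto
    finally show "n * (23 * (r * n^2)) \<le> 23 * real k ^ 2 * (r * n^3)" .
    have "0 \<le> real k ^ 2 * (r * n^3)" using r n by auto
    then show "2 * (122 * 4/3 * r * real k ^ 2 * n^3) \<le> 326 * real k ^ 2 * (r * n^3)" by (simp add: mult_ac)
  qed
  also have "\<dots> \<le> 400 * real k ^ 2 * (r * n^3)" using r n by (simp add: algebra_simps)
  finally show ?thesis by (simp add: r_def)
qed

end

section \<open>Closed 5-walks and copies of the 5-cycle\<close>

lemma cycle_edges_5: "cycle_edges 5 = {{0,1},{1,2},{2,3},{3,4},{4,0}}"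
proof -
  have "{..<5} = {0,1,2,3,4::nat}" by auto
  moreover have "cycle_edges 5 = (\<lambda>i. {i, (i + 1) mod 5}) ` {..<5}"
    unfolding cycle_edges_def by blast
  ultimately show ?thesis by (simp add: numeral_2_eq_2)
qed

lemma C5_copy_of_tuple:
  assumes G: "simple_graph V E" and dist: "distinct [x0,x1,x2,x3,x4]"
    and E: "{{x0,x1},{x1,x2},{x2,x3},{x3,x4},{x4,x0}} \<subseteq> E"
  shows "({x0,x1,x2,x3,x4}, {{x0,x1},{x1,x2},{x2,x3},{x3,x4},{x4,x0}}) \<in> C5_copies V E"
proof -
  define f :: "'a \<Rightarrow> nat" where
    "f x = (if x = x0 then 0 else if x = x1 then 1 else if x = x2 then 2 else if x = x3 then 3 else 4)" for x
  have f: "f x0 = 0" "f x1 = 1" "f x2 = 2" "f x3 = 3" "f x4 = 4"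
    using dist by (auto simp: f_def)
  have "bij_betw f {x0,x1,x2,x3,x4} {..<5}"
  proof (rule bij_betw_imageI)
    show "inj_on f {x0,x1,x2,x3,x4}" unfolding inj_on_def using f by auto
    show "f ` {x0,x1,x2,x3,x4} = {..<5}" using f by auto
  qed
  moreover have "(\<lambda>e. f ` e) ` {{x0,x1},{x1,x2},{x2,x3},{x3,x4},{x4,x0}} = cycle_edges 5"
    unfolding cycle_edges_5 by (simp add: f)
  ultimately have "graph_iso {x0,x1,x2,x3,x4} {{x0,x1},{x1,x2},{x2,x3},{x3,x4},{x4,x0}} {..<5} (cycle_edges 5)"
    unfolding graph_iso_def by blast
  moreover have "simple_graph {x0,x1,x2,x3,x4} {{x0,x1},{x1,x2},{x2,x3},{x3,x4},{x4,x0}}"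
    using dist by (auto simp: simple_graph_def)
  moreover have "{x0,x1,x2,x3,x4} \<subseteq> V" using G E by (auto simp: simple_graph_def)
  ultimately show ?thesis using E by (simp add: C5_copies_def)
qed

lemma finite_C5_copies: "simple_graph V E \<Longrightarrow> finite (C5_copies V E)"
proof -
  assume G: "simple_graph V E"
  then have "finite V" "E \<subseteq> Pow V" by (auto simp: simple_graph_def)
  then have "finite (Pow V \<times> Pow E)" by (meson finite_Pow_iff finite_SigmaI finite_subset)
  then show ?thesis by (rule finite_subset[rotated]) (auto simp: C5_copies_def)
qed

text \<open>Vertices may repeat: these are the closed walks of length five, not only the labelled
  cycles.\<close>

definition cyc_tuples :: "'a set \<Rightarrow> 'a set set \<Rightarrow> ('a \<times> 'a \<times> 'a \<times> 'a \<times> 'a) set" where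
  "cyc_tuples V E = {(x0,x1,x2,x3,x4). {x0,x1,x2,x3,x4} \<subseteq> V \<and>
     {{x0,x1},{x1,x2},{x2,x3},{x3,x4},{x4,x0}} \<subseteq> E}"

text \<open>The first two entries determine a labelling, because \<open>F\<close> then forces each
  next vertex, and they form one of the ten ordered edges of \<open>F\<close>.\<close>

lemma C5_labelings_le:
  fixes F :: "'a set set"
  defines "T \<equiv> {(x0,x1,x2,x3,x4). distinct [x0,x1,x2,x3,x4] \<and>
     F = {{x0,x1},{x1,x2},{x2,x3},{x3,x4},{x4,x0}}}"
  shows "finite T \<and> card T \<le> 10"
proof (cases "T = {}")
  case False
  then obtain y0 y1 y2 y3 y4 where y: "F = {{y0,y1},{y1,y2},{y2,y3},{y3,y4},{y4,y0}}" unfolding T_def by blast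
  let ?p = "\<lambda>(x0,x1,x2,x3,x4). (x0,x1)"
  let ?L = "[(y0,y1),(y1,y2),(y2,y3),(y3,y4),(y4,y0),(y1,y0),(y2,y1),(y3,y2),(y4,y3),(y0,y4)]"
  have inj: "inj_on ?p T"
    unfolding T_def
  proof (rule inj_onI, clarsimp)
    fix a b x2 x3 x4 z2 z3 z4
    assume F: "{{a, b}, {b, x2}, {x2, x3}, {x3, x4}, {x4, a}} = {{a, b}, {b, z2}, {z2, z3}, {z3, z4}, {z4, a}}"
      (is "?F = ?G")
      and d: "a \<noteq> b" "a \<noteq> x2" "a \<noteq> x3" "a \<noteq> x4" "b \<noteq> x2" "b \<noteq> x3" "b \<noteq> x4" "x2 \<noteq> x3" "x2 \<noteq> x4" "x3 \<noteq> x4"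
        "a \<noteq> z2" "a \<noteq> z3" "a \<noteq> z4" "b \<noteq> z2" "b \<noteq> z3" "b \<noteq> z4" "z2 \<noteq> z3" "z2 \<noteq> z4" "z3 \<noteq> z4"
    have "{b, x2} \<in> ?G" unfolding F[symmetric] by simp
    then have 2: "x2 = z2" using d by (auto simp: doubleton_eq_iff)
    have "{x2, x3} \<in> ?G" unfolding F[symmetric] by simp
    then have 3: "x3 = z3" using d 2 by (auto simp: doubleton_eq_iff)
    have "{x3, x4} \<in> ?G" unfolding F[symmetric] by simp
    then have "x4 = z4" using d 2 3 by (auto simp: doubleton_eq_iff)
    with 2 3 show "x2 = z2 \<and> x3 = z3 \<and> x4 = z4" by simp
  qed
  have sub: "?p ` T \<subseteq> set ?L"
  proof (rule image_subsetI)
    fix t assume "t \<in> T"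
    then obtain u v c e f where t: "t = (u,v,c,e,f)" "F = {{u,v},{v,c},{c,e},{e,f},{f,u}}"
      unfolding T_def by blast
    then have "{u,v} \<in> F" by simp
    then show "?p t \<in> set ?L" unfolding y t(1) by (auto simp: doubleton_eq_iff)
  qed
  then have "card (?p ` T) \<le> card (set ?L)" by (intro card_mono) auto
  also have "\<dots> \<le> 10" using card_length[of ?L] by simp
  finally have "card T \<le> 10" using card_image[OF inj] by simp
  moreover have "finite T" using finite_subset[OF sub] inj by (metis finite_imageD finite_set)
  ultimately show ?thesis by simp
qed simp

text \<open>An injective closed walk labels a copy, which has at most ten labellings. In any other,
  consecutive entries still differ, so two non-consecutive entries coincide and at most four
  vertices are free.\<close>

lemma card_cyc_tuples_le:
  assumes G: "simple_graph V E"
  shows "card (cyc_tuples V E) \<le> 10 * card (C5_copies V E) + 5 * card V ^ 4"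
proof -
  define I where "I = {(x0,x1,x2,x3,x4) \<in> cyc_tuples V E. distinct [x0,x1,x2,x3,x4]}"
  define fib where "fib F = {(x0,x1,x2,x3,x4). distinct [x0,x1,x2,x3,x4] \<and>
     F = {{x0,x1},{x1,x2},{x2,x3},{x3,x4},{x4,x0}}}" for F :: "'a set set"
  let ?V4 = "V \<times> V \<times> V \<times> V"
  have finV: "finite V" using G by (simp add: simple_graph_def)
  have fin: "finite (cyc_tuples V E)"
    by (rule finite_subset[of _ "V \<times> V \<times> V \<times> V \<times> V"]) (use finV in \<open>auto simp: cyc_tuples_def\<close>)
  have noloop: "{x, x} \<notin> E" for x using G by (auto simp: simple_graph_def)
  have finI: "finite I" by (rule finite_subset[OF _ fin]) (auto simp: I_def)
  have I: "card I \<le> 10 * card (C5_copies V E)"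
  proof -
    have "I \<subseteq> (\<Union>p\<in>C5_copies V E. I \<inter> fib (snd p))"
    proof (rule subsetI)
      fix t assume t: "t \<in> I"
      obtain x0 x1 x2 x3 x4 where tx: "t = (x0,x1,x2,x3,x4)" by (cases t) auto
      then have "({x0,x1,x2,x3,x4}, {{x0,x1},{x1,x2},{x2,x3},{x3,x4},{x4,x0}}) \<in> C5_copies V E"
        using t by (intro C5_copy_of_tuple[OF G]) (auto simp: I_def cyc_tuples_def)
      moreover have "t \<in> fib (snd ({x0,x1,x2,x3,x4}, {{x0,x1},{x1,x2},{x2,x3},{x3,x4},{x4,x0}}))"
        using t by (simp add: tx I_def fib_def)
      ultimately show "t \<in> (\<Union>p\<in>C5_copies V E. I \<inter> fib (snd p))" using t by blast
    qed
    then have "card I \<le> card (\<Union>p\<in>C5_copies V E. I \<inter> fib (snd p))"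
      using finI finite_C5_copies[OF G] by (intro card_mono) auto
    also have "\<dots> \<le> (\<Sum>p\<in>C5_copies V E. card (I \<inter> fib (snd p)))"
      by (rule card_UN_le[OF finite_C5_copies[OF G]])
    also have "\<dots> \<le> (\<Sum>p\<in>C5_copies V E. 10)"
    proof (rule sum_mono)
      fix p :: "'a set \<times> 'a set set"
      have "card (I \<inter> fib (snd p)) \<le> card (fib (snd p))"
        using C5_labelings_le[of "snd p"] unfolding fib_def by (intro card_mono) auto
      then show "card (I \<inter> fib (snd p)) \<le> 10"
        using C5_labelings_le[of "snd p"] unfolding fib_def by linarith
    qed
    finally show ?thesis by (simp add: mult.commute)
  qed
  \<comment> \<open>One map for each of the five pairs of non-consecutive positions on the
    cycle.\<close>
  let ?D = "[\<lambda>(x,y,z,w). (x,y,x,z,w), \<lambda>(x,y,z,w). (x,y,z,x,w), \<lambda>(x,y,z,w). (x,y,z,y,w),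
      \<lambda>(x,y,z,w). (x,y,z,w,y), \<lambda>(x,y,z,w). (x,y,z,w,z)] :: ('a \<times> 'a \<times> 'a \<times> 'a \<Rightarrow> 'a \<times> 'a \<times> 'a \<times> 'a \<times> 'a) list"
  have "cyc_tuples V E \<subseteq> I \<union> (\<Union>i<5. (?D ! i) ` ?V4)"
  proof (rule subsetI)
    fix t assume t: "t \<in> cyc_tuples V E"
    obtain x0 x1 x2 x3 x4 where tx: "t = (x0,x1,x2,x3,x4)" by (cases t) auto
    have ne: "x0 \<noteq> x1" "x1 \<noteq> x2" "x2 \<noteq> x3" "x3 \<noteq> x4" "x4 \<noteq> x0"
      using t noloop by (auto simp: cyc_tuples_def tx)
    have V: "x0 \<in> V" "x1 \<in> V" "x2 \<in> V" "x3 \<in> V" "x4 \<in> V" using t by (auto simp: cyc_tuples_def tx)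
    consider "distinct [x0,x1,x2,x3,x4]" | "x2 = x0" | "x3 = x0" | "x3 = x1" | "x4 = x1" | "x4 = x2"
      using ne by auto
    then show "t \<in> I \<union> (\<Union>i<5. (?D ! i) ` ?V4)"
    proof cases
      case 1 then show ?thesis using t by (simp add: tx I_def)
    next
      case 2
      then show ?thesis
        by (intro UnI2 UN_I[of 0] image_eqI[of _ _ "(x0,x1,x3,x4)"]) (use V in \<open>auto simp: tx\<close>)
    next
      case 3
      then show ?thesis
        by (intro UnI2 UN_I[of 1] image_eqI[of _ _ "(x0,x1,x2,x4)"]) (use V in \<open>auto simp: tx\<close>)
    next
      case 4
      then show ?thesis
        by (intro UnI2 UN_I[of 2] image_eqI[of _ _ "(x0,x1,x2,x4)"]) (use V in \<open>auto simp: tx\<close>)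
    next
      case 5
      then show ?thesis
        by (intro UnI2 UN_I[of 3] image_eqI[of _ _ "(x0,x1,x2,x3)"]) (use V in \<open>auto simp: tx\<close>)
    next
      case 6
      then show ?thesis
        by (intro UnI2 UN_I[of 4] image_eqI[of _ _ "(x0,x1,x2,x3)"]) (use V in \<open>auto simp: tx\<close>)
    qed
  qed
  then have "card (cyc_tuples V E) \<le> card (I \<union> (\<Union>i<5. (?D ! i) ` ?V4))"
    by (intro card_mono) (use finV finI in auto)
  also have "\<dots> \<le> card I + (\<Sum>i<5. card ((?D ! i) ` ?V4))"
    by (rule order_trans[OF card_Un_le]) (intro add_left_mono card_UN_le, simp)
  also have "(\<Sum>i<5. card ((?D ! i) ` ?V4)) \<le> (\<Sum>i<5::nat. card ?V4)"
    by (intro sum_mono card_image_le) (use finV in auto)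
  also have "\<dots> = 5 * card V ^ 4" by (simp add: card_cartesian_product power4_eq_xxxx)
  finally show ?thesis using I by linarith
qed

section \<open>Edge count, edit distance and the matrix of a graph\<close>

lemma card_ordered_edges:
  assumes G: "simple_graph V E"
  shows "card {(x, y) \<in> V \<times> V. {x, y} \<in> E} = 2 * card E"
proof -
  have finE: "finite E" using G by (auto simp: simple_graph_def intro: finite_subset[of _ "Pow V"])
  have two: "card {(x, y). {x, y} = e} = 2 \<and> finite {(x, y). {x, y} = e}" if "e \<in> E" for e
  proof -
    from that G have "card e = 2" by (auto simp: simple_graph_def)
    then obtain u v where e: "e = {u, v}" "u \<noteq> v" by (auto simp: card_2_iff)
    then have "{(x, y). {x, y} = e} = {(u, v), (v, u)}" by (auto simp: doubleton_eq_iff)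
    then show ?thesis using e by simp
  qed
  have "{(x, y) \<in> V \<times> V. {x, y} \<in> E} = (\<Union>e\<in>E. {(x, y). {x, y} = e})"
    using G by (auto simp: simple_graph_def)
  also have "card \<dots> = (\<Sum>e\<in>E. card {(x, y). {x, y} = e})"
    by (rule card_UN_disjoint) (use finE two in auto)
  also have "\<dots> = 2 * card E" using two by simp
  finally show ?thesis .
qed

lemma edit_distance_le:
  assumes "simple_graph V T"
  shows "edit_distance V E T \<le> card ((E - T) \<union> (T - E))"
proof -
  let ?C = "{F'. simple_graph V F' \<and> graph_iso V F' V T}"
  have "?C \<subseteq> Pow (Pow V)" by (auto simp: simple_graph_def)
  moreover have "finite (Pow (Pow V))" using assms by (simp add: simple_graph_def)
  ultimately have "finite ?C" by (rule finite_subset)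
  moreover have "graph_iso V T V T"
    unfolding graph_iso_def by (rule exI[of _ id]) auto
  ultimately show ?thesis
    unfolding edit_distance_def using assms by (intro Min_le) auto
qed

text \<open>In a simple graph the diagonal gets the value 1, so a complete multipartite graph yields
  the indicator of an equivalence relation.\<close>

definition nonadj :: "'a set set \<Rightarrow> 'a \<Rightarrow> 'a \<Rightarrow> real" where
  "nonadj E x y = (if {x, y} \<in> E then 0 else 1)"

lemma nonadjacency_nonadj: "finite V \<Longrightarrow> nonadjacency V (nonadj E)"
  by unfold_locales (auto simp: nonadj_def insert_commute)

lemma sum_nonadj:
  assumes G: "simple_graph V E"
  shows "nonadjacency.deg_sum V (nonadj E) = real (card V)^2 - 2 * real (card E)"
proof -
  interpret nonadjacency V "nonadj E" using G by (intro nonadjacency_nonadj) (simp add: simple_graph_def)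
  have "deg_sum = (\<Sum>x\<in>V. \<Sum>y\<in>V. 1 - (if {x, y} \<in> E then 1 else 0))"
    unfolding deg_sum_def deg_def by (intro sum.cong refl) (simp add: nonadj_def)
  also have "\<dots> = real (card V)^2 - real (card {(x, y) \<in> V \<times> V. {x, y} \<in> E})"
    unfolding card_pairs by (simp add: sum_subtractf power2_eq_square)
  finally show ?thesis unfolding card_ordered_edges[OF G] by simp
qed

text \<open>The five factors of a summand of the trace are indicators of the edges of a closed walk,
  so the trace counts closed walks.\<close>

lemma adj_closed5_le_card_copies:
  assumes G: "simple_graph V E"
  shows "nonadjacency.adj_closed5 V (nonadj E) \<le> 10 * real (card (C5_copies V E)) + 5 * real (card V) ^ 4"
proof -
  interpret nonadjacency V "nonadj E" using G by (intro nonadjacency_nonadj) (simp add: simple_graph_def)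
  let ?P = "\<lambda>(x,y,z,v,w). {x,y} \<in> E \<and> {x,v} \<in> E \<and> {v,z} \<in> E \<and> {z,w} \<in> E \<and> {w,y} \<in> E"
  let ?V5 = "V \<times> V \<times> V \<times> V \<times> V"
  let ?H = "{t \<in> ?V5. ?P t}"
  have fin: "finite ?V5" using finV by simp
  have "adj_closed5 = (\<Sum>x\<in>V. \<Sum>y\<in>V. \<Sum>z\<in>V. \<Sum>v\<in>V. \<Sum>w\<in>V. if ?P (x,y,z,v,w) then 1 else 0)"
    unfolding adj_closed5_def adj_codeg_def unfolding sum_product unfolding sum_distrib_left
    by (intro sum.cong refl) (simp add: nonadj_def)
  also have "\<dots> = (\<Sum>t\<in>?V5. if ?P t then 1 else 0)"
    unfolding sum.cartesian_product by (intro sum.cong refl) (simp add: case_prod_unfold)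
  also have "\<dots> = real (card (?V5 \<inter> {t. ?P t}))"
    using fin by (simp only: sum.If_cases) simp
  also have "?V5 \<inter> {t. ?P t} = ?H" by blast
  finally have "adj_closed5 = real (card ?H)" .
  also have "card ?H \<le> card (cyc_tuples V E)"
  \<comment> \<open>In the nested sums \<open>v\<close> lies between \<open>x\<close> and
    \<open>z\<close>, and \<open>w\<close> between \<open>z\<close> and \<open>y\<close>; the map
    restores the cyclic order.\<close>
  proof (rule card_inj_on_le[of "\<lambda>(x,y,z,v,w). (x,v,z,w,y)"])
    show "inj_on (\<lambda>(x,y,z,v,w). (x,v,z,w,y)) ?H" by (auto simp: inj_on_def)
    show "(\<lambda>(x,y,z,v,w). (x,v,z,w,y)) ` ?H \<subseteq> cyc_tuples V E"
      by (auto simp: cyc_tuples_def insert_commute)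
    show "finite (cyc_tuples V E)"
      by (rule finite_subset[OF _ fin]) (auto simp: cyc_tuples_def)
  qed
  also have "card (cyc_tuples V E) \<le> 10 * card (C5_copies V E) + 5 * card V ^ 4"
    by (rule card_cyc_tuples_le[OF G])
  finally show ?thesis by simp
qed

text \<open>Forgetting the order of the disagreeing pairs covers the symmetric difference of
  \<open>E\<close> and the complete multipartite graph on the parts.\<close>

lemma close_to_turan_graph:
  assumes G: "simple_graph V E"
    and P: "disjoint_family_on P {..<k}" "(\<Union>i<k. P i) = V" "\<forall>i<k. \<forall>j<k. card (P i) \<le> card (P j) + 1"
  shows "\<exists>T. is_turan_graph k V T \<and> edit_distance V E T \<le>
     card {(y, z) \<in> V \<times> V. (nonadj E y z = 1) \<noteq> (\<exists>i<k. y \<in> P i \<and> z \<in> P i)}"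
proof -
  define T where "T = {{u, v} |u v. \<exists>i<k. \<exists>j<k. i \<noteq> j \<and> u \<in> P i \<and> v \<in> P j}"
  let ?Dis = "{(y, z) \<in> V \<times> V. (nonadj E y z = 1) \<noteq> (\<exists>i<k. y \<in> P i \<and> z \<in> P i)}"
  have finV: "finite V" using G by (simp add: simple_graph_def)
  have turan: "is_turan_graph k V T"
    unfolding is_turan_graph_def T_def using finV P by blast
  have disj: "i = j" if "i < k" "j < k" "x \<in> P i" "x \<in> P j" for i j x
    using P(1) that unfolding disjoint_family_on_def by blast
  have "simple_graph V T"
    unfolding simple_graph_def
  proof (intro conjI subsetI CollectI)
    fix e assume "e \<in> T"
    then obtain u v i j where e: "e = {u, v}" "i < k" "j < k" "i \<noteq> j" "u \<in> P i" "v \<in> P j"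
      unfolding T_def by blast
    then have "u \<noteq> v" using disj by blast
    then show "card e = 2" using e by simp
    show "x \<in> V" if "x \<in> e" for x using that e P(2) by blast
  qed (fact finV)
  then have "edit_distance V E T \<le> card ((E - T) \<union> (T - E))" by (rule edit_distance_le)
  also have "\<dots> \<le> card ?Dis"
  proof (rule surj_card_le)
    show "finite ?Dis" by (rule finite_subset[of _ "V \<times> V"]) (use finV in auto)
    show "(E - T) \<union> (T - E) \<subseteq> (\<lambda>(y, z). {y, z}) ` ?Dis"
    proof
      fix e assume "e \<in> (E - T) \<union> (T - E)"
      then consider "e \<in> E" "e \<notin> T" | "e \<in> T" "e \<notin> E" by blast
      then show "e \<in> (\<lambda>(y, z). {y, z}) ` ?Dis"
      proof cases
        case 1
        then have "card e = 2" "e \<subseteq> V" using G by (auto simp: simple_graph_def)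
        then obtain y z where e: "e = {y, z}" "y \<in> V" "z \<in> V" by (auto simp: card_2_iff)
        then obtain i j where ij: "i < k" "j < k" "y \<in> P i" "z \<in> P j" using P(2) by blast
        then have "i = j" using 1(2) unfolding T_def e by blast
        moreover have "nonadj E y z = 0" using 1 e by (simp add: nonadj_def)
        ultimately have "(y, z) \<in> ?Dis" using ij e by auto
        then show ?thesis using e(1) by (intro image_eqI[of _ _ "(y, z)"]) auto
      next
        case 2
        then obtain y z i j where e: "e = {y, z}" "i < k" "j < k" "i \<noteq> j" "y \<in> P i" "z \<in> P j"
          unfolding T_def by blast
        then have "\<not> (\<exists>i<k. y \<in> P i \<and> z \<in> P i)" using disj by blast
        moreover have "nonadj E y z = 1" using 2 e by (simp add: nonadj_def)
        moreover have "y \<in> V" "z \<in> V" using e P(2) by blast+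
        ultimately have "(y, z) \<in> ?Dis" by simp
        then show ?thesis using e(1) by (intro image_eqI[of _ _ "(y, z)"]) auto
      qed
    qed
  qed
  finally show ?thesis using turan by blast
qed

section \<open>Choice of the constants and conclusion\<close>

theorem theorem2:
  fixes k :: nat and p lam \<delta> :: real
  assumes "k \<ge> 3"
    and "p = 1 - 1 / real k"
    and "lam = 1/10 - 1 / (2 * real k) + 1 / real k ^ 2 - 1 / real k ^ 3 + 2 / (5 * real k ^ 4)"
    and "\<delta> > 0"
  shows "\<exists>\<epsilon>>0. \<forall>(V :: 'a set) E.
           simple_graph V E \<and>
           real (card V) \<ge> 1 / \<epsilon> \<and>
           real (card E) \<ge> (p - \<epsilon>) * real (card V choose 2) \<and>
           real (card (C5_copies V E)) \<le> (lam + \<epsilon>) * real (card V) ^ 5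
           \<longrightarrow> (\<exists>T. is_turan_graph k V T \<and>
                    real (edit_distance V E T) \<le> \<delta> * real (card V) ^ 2)"
proof -
  define a where "a = 1 / real k"
  \<comment> \<open>The first bound gives \<open>3 * real k ^ 2 * \<sigma> < 1\<close> for the
    greedy choice, the second turns the final error \<open>5 * real k ^ 2 * \<sigma>\<close> into
    \<open>\<delta>\<close>.\<close>
  define \<sigma> where "\<sigma> = min (1 / (4 * real k ^ 2)) (\<delta> / (5 * real k ^ 2))"
  \<comment> \<open>\<open>\<epsilon> \<le> \<sigma>\<close> makes \<open>n\<close> large enough for
    rounding; the squared term offsets the square root in \<open>defect_sum_bound\<close>.\<close>
  define \<epsilon> where "\<epsilon> = min (min 1 \<sigma>) ((\<sigma>^4 / (200 * real k ^ 2))^2)"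
  have k2: "real k ^ 2 > 0" using assms(1) by simp
  have \<sigma>0: "\<sigma> > 0" using k2 assms(4) by (simp add: \<sigma>_def)
  have "\<sigma> \<le> 1 / (4 * real k ^ 2)" by (simp add: \<sigma>_def)
  then have \<sigma>1: "3 * real k ^ 2 * \<sigma> < 1" using k2 \<sigma>0 by (simp add: field_simps)
  have "\<sigma> \<le> \<delta> / (5 * real k ^ 2)" by (simp add: \<sigma>_def)
  then have \<sigma>2: "5 * real k ^ 2 * \<sigma> \<le> \<delta>" using k2 by (simp add: field_simps)
  have e0: "\<epsilon> > 0" using \<sigma>0 k2 by (simp add: \<epsilon>_def)
  have e1: "\<epsilon> \<le> 1" "\<epsilon> \<le> \<sigma>" by (auto simp: \<epsilon>_def)
  have "sqrt \<epsilon> \<le> \<sigma>^4 / (200 * real k ^ 2)"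
    by (rule real_le_lsqrt) (use e0 \<sigma>0 in \<open>auto simp: \<epsilon>_def\<close>)
  then have "200 * (real k ^ 2 * sqrt \<epsilon>) \<le> \<sigma>^4"
    using k2 by (simp add: field_simps)
  moreover have "0 < \<sigma>^4" using \<sigma>0 by simp
  ultimately have sqrt_e: "400 * real k ^ 2 * sqrt \<epsilon> \<le> 3 * \<sigma>^4"
    by linarith
  have a0: "0 \<le> a" by (simp add: a_def)
  \<comment> \<open>A copy has ten labellings, and \<open>10 * lam\<close> is the value of the
    quartic at \<open>1 / real k\<close>.\<close>
  have lam: "10 * lam = 1 - 5 * a + 10 * a^2 - 10 * a^3 + 4 * a^4"
    by (simp add: assms(3) a_def power_one_over field_simps)
  show ?thesis
  proof (intro exI[of _ \<epsilon>] conjI e0 allI impI, elim conjE)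
    fix V :: "'a set" and E
    assume G: "simple_graph V E" and card_V: "real (card V) \<ge> 1 / \<epsilon>"
      and card_E: "real (card E) \<ge> (p - \<epsilon>) * real (card V choose 2)"
      and copies: "real (card (C5_copies V E)) \<le> (lam + \<epsilon>) * real (card V) ^ 5"
    interpret nonadjacency V "nonadj E"
      using G by (intro nonadjacency_nonadj) (simp add: simple_graph_def)
    have "0 < 1 / \<epsilon>" using e0 by simp
    then have n: "n > 0" using card_V unfolding n_def by linarith
    have en: "1 \<le> \<epsilon> * n" using card_V e0 by (simp add: n_def field_simps)
    have ch: "n * (n - 1) = 2 * real (card V choose 2)"
    proof -
      have "2 * (card V choose 2) = card V * (card V - 1)"
        using times_binomial_minus1_eq[of 2 "card V"] by simp
      then have "2 * real (card V choose 2) = real (card V) * real (card V - 1)"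
        by (metis of_nat_mult of_nat_numeral)
      moreover have "real (card V - 1) = n - 1" using n by (simp add: n_def of_nat_diff Suc_leI)
      ultimately show ?thesis by (simp add: n_def)
    qed
    have E2: "2 * real (card E) \<ge> (1 - a - \<epsilon>) * (n * (n - 1))"
      using card_E unfolding assms(2) a_def[symmetric] ch by (simp add: mult.left_commute)
    have "deg_sum = n^2 - 2 * real (card E)" using sum_nonadj[OF G] by (simp add: n_def)
    also have "\<dots> \<le> (a + \<epsilon>) * n^2 + n - (a + \<epsilon>) * n"
      using E2 by (simp add: algebra_simps power2_eq_square)
    \<comment> \<open>The linear term left by the binomial coefficient is absorbed by
      \<open>1 \<le> \<epsilon> * n\<close>.\<close>
    also have "\<dots> \<le> (a + \<epsilon>) * n^2 + \<epsilon> * n * n"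
      using mult_right_mono[OF en, of n] n a0 e0
      by (smt (verit) mult_nonneg_nonneg)
    finally have deg_sum: "deg_sum \<le> (a + 2 * \<epsilon>) * n^2" by (simp add: algebra_simps power2_eq_square)
    have "adj_closed5 \<le> 10 * ((lam + \<epsilon>) * n^5) + 5 * n^4"
      using adj_closed5_le_card_copies[OF G] copies by (simp add: n_def)
    \<comment> \<open>The non-injective closed walks are absorbed in the same way.\<close>
    also have "\<dots> \<le> 10 * ((lam + \<epsilon>) * n^5) + 5 * (\<epsilon> * n * n^4)"
      using mult_right_mono[OF en, of "n^4"] by simp
    also have "\<dots> \<le> (10 * lam + 20 * \<epsilon>) * n^5"
      using e0 n by (simp add: algebra_simps numeral_eq_Suc)
    finally have adj_closed5: "adj_closed5 \<le> (1 - 5 * a + 10 * a^2 - 10 * a^3 + 4 * a^4 + 20 * \<epsilon>) * n^5"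
      unfolding lam .
    have "(\<Sum>x\<in>V. defect (n / k) x) \<le> 400 * real k ^ 2 * sqrt \<epsilon> * n^3"
      using defect_sum_bound[OF assms(1) n e0 e1(1)] deg_sum adj_closed5 unfolding a_def by blast
    also have "\<dots> \<le> 3 * \<sigma>^4 * n^3" using sqrt_e n by (intro mult_right_mono) auto
    finally have tot: "(\<Sum>x\<in>V. defect (n / k) x) \<le> 3 * \<sigma>^4 * n^3" .
    have "1 \<le> \<sigma> * n" using en e1(2) n by (meson mult_right_mono order_trans less_imp_le)
    from near_balanced_partition[OF assms(1) n \<sigma>0 \<sigma>1 this tot] obtain P where
      P: "disjoint_family_on P {..<k}" "(\<Union>i<k. P i) = V" "\<forall>i<k. \<forall>j<k. card (P i) \<le> card (P j) + 1"
      and dis: "card {(y, z) \<in> V \<times> V. (nonadj E y z = 1) \<noteq> (\<exists>i<k. y \<in> P i \<and> z \<in> P i)}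
        \<le> 5 * real k ^ 2 * \<sigma> * n^2"
      by blast
    from close_to_turan_graph[OF G P] obtain T where T: "is_turan_graph k V T"
      "edit_distance V E T \<le> card {(y, z) \<in> V \<times> V. (nonadj E y z = 1) \<noteq> (\<exists>i<k. y \<in> P i \<and> z \<in> P i)}"
      by blast
    have "real (edit_distance V E T) \<le> 5 * real k ^ 2 * \<sigma> * n^2" using T(2) dis by linarith
    also have "\<dots> \<le> \<delta> * n^2" using \<sigma>2 by (intro mult_right_mono) auto
    finally show "\<exists>T. is_turan_graph k V T \<and> real (edit_distance V E T) \<le> \<delta> * real (card V) ^ 2"
      using T(1) unfolding n_def by blast
  qed
qed

end
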